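(* Let $n,m\ge1$ be integers and let $a_1,\dots,a_n$ be independently and randomly chosen from the uniform distribution in $S^m$. Denote by $A$ the matrix with rows $a_1,\dots,a_n$. For $\alpha\in[0,\pi]$ set $\varepsilon:=|\cos(\alpha)|$ and let $p(n,m,\alpha)=\mathsf{Prob}\{S^m\ne\bigcup_{i=1}^n\mathsf{cap}(a_i,\alpha)\}$. Then $$p(n,m,\alpha)=\begin{cases}\mathsf{Prob}\bigl\{A\in\mathcal F_{n,m}\text{ and }\mathscr C(A)\le\frac1\varepsilon\bigr\},&\text{if }\alpha\in[\pi/2,\pi],\\[4pt]\dfrac{\sum_{k=0}^m\binom{n-1}{k}}{2^{n-1}}+\mathsf{Prob}\bigl\{A\notin\mathcal F_{n,m}\text{ and }\mathscr C(A)\ge\frac1\varepsilon\bigr\},&\text{if }\alpha\in[0,\pi/2].\end{cases}$$ In particular, $p(n,m,\pi/2)=\mathsf{Prob}\{A\in\mathcal F_{n,m}\}=2^{1-n}\sum_{k=0}^m\binom{n-1}{k}$.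
   Context: $S^m$ is the unit sphere in $\mathbb R^{m+1}$; $\mathsf{cap}(p,\alpha)=\{x\in S^m\mid\langle p,x\rangle\ge\cos\alpha\}$ for $p\in S^m$, $\alpha\in[0,\pi]$. A point $(a_1,\dots,a_n)\in(S^m)^n$ is identified with the matrix $A$ with rows $a_1,\dots,a_n$. The feasible set is $\mathcal F_{n,m}=\{A\in(S^m)^n\mid\exists x\in S^m\ \langle a_1,x\rangle\le0,\dots,\langle a_n,x\rangle\le0\}$. A smallest including cap of $A$ is a spherical cap of minimal angular radius containing $a_1,\dots,a_n$; this minimal radius, uniquely determined by $A$, is denoted $\rho(A)$. The GCC condition number is $\mathscr C(A):=1/|\cos\rho(A)|$. Conventions: $1/0=\infty$.
   Formalization: The first formula is proved except when n = 1 and α = π: there the closed cap is all of S^m, so p(1,m,π) = 0, while A is feasible with C(A) = 1 = 1/ε, so the right-hand side is 1 and the equation fails. *)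

theory Defs
  imports "HOL-Probability.Probability"
begin

text \<open>The sphere \<open>S\<^sup>m\<close> is \<^term>\<open>sphere 0 1\<close> in a Euclidean space of dimension \<open>m + 1\<close>.
  An \<open>n\<close>-tuple of points (equivalently, the matrix having them as rows) is a function
  \<open>A\<close> in \<^term>\<open>{..<n} \<rightarrow>\<^sub>E sphere 0 1\<close>.\<close>

text \<open>Caps are closed: \<open>cap p pi\<close> is the entire sphere and \<open>cap p 0\<close> is the point \<open>p\<close>.\<close>
definition cap :: "'a::euclidean_space \<Rightarrow> real \<Rightarrow> 'a set" where
  "cap p \<alpha> = {x \<in> sphere 0 1. p \<bullet> x \<ge> cos \<alpha>}"

definition feasible_set :: "nat \<Rightarrow> (nat \<Rightarrow> 'a::euclidean_space) set" where
  "feasible_set n =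
     {A \<in> {..<n} \<rightarrow>\<^sub>E sphere 0 1. \<exists>x\<in>sphere 0 1. \<forall>i<n. A i \<bullet> x \<le> 0}"

text \<open>The smallest radius exists for every \<open>A \<in> {..<n} \<rightarrow>\<^sub>E sphere 0 1\<close>, because the sphere is compact.\<close>
definition smallest_cap_radius :: "nat \<Rightarrow> (nat \<Rightarrow> 'a::euclidean_space) \<Rightarrow> real" where
  "smallest_cap_radius n A =
     (LEAST r. r \<in> {0..pi} \<and> (\<exists>p\<in>sphere 0 1. \<forall>i<n. A i \<in> cap p r))"

text \<open>On \<^typ>\<open>ennreal\<close>, \<open>1 / 0 = \<infinity>\<close>.\<close>
definition GCC_cond :: "nat \<Rightarrow> (nat \<Rightarrow> 'a::euclidean_space) \<Rightarrow> ennreal" where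
  "GCC_cond n A = 1 / ennreal \<bar>cos (smallest_cap_radius n A)\<bar>"

text \<open>The normalised surface measure of the unit sphere, as the law of \<open>x / \<parallel>x\<parallel>\<close> for \<open>x\<close> uniform
  in the unit ball: the measure of \<open>B\<close> is the relative volume of the cone
  \<open>{t x | x \<in> B, 0 < t < 1}\<close>. The centre, where \<^term>\<open>sgn\<close> leaves the sphere, is a null set.\<close>
definition uniform_sphere :: "'a::euclidean_space measure" where
  "uniform_sphere =
     restrict_space (distr (uniform_measure lborel (ball 0 1)) borel sgn) (sphere 0 1)"

end

theory Submission
  imports Defs
begin

text \<open>Write \<open>t(A)\<close> for the maximum over unit vectors \<open>x\<close> of \<open>min\<^sub>i a\<^sub>i \<bullet> x\<close>. A cap with centre \<open>x\<close> and angular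
  radius \<open>r\<close> contains all points iff \<open>cos r \<le> min\<^sub>i a\<^sub>i \<bullet> x\<close>, so \<open>t(A) = cos \<rho>(A)\<close>
  (\<open>cos_smallest_cap_radius_ge_iff\<close>), and feasibility means \<open>t(A) \<ge> 0\<close>. Passing to antipodes, the caps of
  radius \<open>\<alpha>\<close> fail to cover the sphere iff \<open>t(A) > - cos \<alpha>\<close> (\<open>not_covered_iff_in_open_cap\<close>). With
  \<open>\<epsilon> = \<bar>cos \<alpha>\<bar>\<close> this is the event \<open>t > \<epsilon>\<close> for \<open>\<alpha> \<ge> \<pi>/2\<close> and \<open>t > - \<epsilon>\<close> for \<open>\<alpha> \<le> \<pi>/2\<close>, whereas the
  events in terms of the condition number are \<open>t \<ge> \<epsilon>\<close> and \<open>- \<epsilon> \<le> t < 0\<close>. The proposition thus reduces to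
  two probabilistic facts.

  First, \<open>t(A)\<close> takes each relevant value with probability \<open>0\<close>
  (\<open>AE_in_open_cap_iff_closed\<close>). For \<open>\<bar>c\<bar> < 1\<close>, replace the points on the sphere by points \<open>y\<^sub>i\<close> of the ball
  that project to them. Shifting all \<open>y\<^sub>i\<close> by a small multiple of a vector close to the centre of a
  smallest cap strictly increases \<open>t\<close>, hence the event \<open>t = c\<close> is covered by finitely many sets,
  each having infinitely many disjoint translates in a bounded region (\<open>null_near_direction\<close>). If
  \<open>t = 1\<close>, all points coincide, which has probability \<open>0\<close> for two or more points; \<open>t = - 1\<close> is impossible
  because the antipodes of finitely many points do not exhaust the sphere.

  Second, Wendel's formula for the probability of \<open>t > 0\<close> (\<open>prob_in_open_hemisphere\<close>): by symmetry it is
  \<open>2\<^sup>-\<^sup>n\<close> times the expected number of cells into which the hyperplanes orthogonal to the \<open>a\<^sub>i\<close> divide the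
  space. Almost surely the points are in general position (\<open>AE_in_general_position\<close>), and then
  deletion and restriction of a hyperplane determine the number of cells (\<open>card_sign_patterns\<close>).\<close>

section \<open>Caps containing all points\<close>

text \<open>With \<open>t(A) = max\<^sub>x min\<^sub>i A\<^sub>i \<bullet> x\<close>, maximum over the unit sphere, the next two predicates say
  \<open>c < t(A)\<close> and \<open>c \<le> t(A)\<close>. Stating them through a centre \<open>x\<close> makes them speak of caps
  directly and spares the existence of the maximum.\<close>
definition in_open_cap :: "nat \<Rightarrow> real \<Rightarrow> (nat \<Rightarrow> 'a::euclidean_space) \<Rightarrow> bool" where
  "in_open_cap n c A \<longleftrightarrow> (\<exists>x\<in>sphere 0 1. \<forall>i<n. c < A i \<bullet> x)"

definition in_closed_cap :: "nat \<Rightarrow> real \<Rightarrow> (nat \<Rightarrow> 'a::euclidean_space) \<Rightarrow> bool" where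
  "in_closed_cap n c A \<longleftrightarrow> (\<exists>x\<in>sphere 0 1. \<forall>i<n. c \<le> A i \<bullet> x)"

lemma in_closed_cap_if_open: "in_open_cap n c A \<Longrightarrow> in_closed_cap n c A"
  unfolding in_open_cap_def in_closed_cap_def by (meson less_imp_le)

lemma in_closed_cap_antimono: "in_closed_cap n d A \<Longrightarrow> c \<le> d \<Longrightarrow> in_closed_cap n c A"
  unfolding in_closed_cap_def by (meson order_trans)

lemma ex_sphere_uminus:
  fixes P :: "'a::euclidean_space \<Rightarrow> bool"
  shows "(\<exists>x\<in>sphere 0 1. P (- x)) \<longleftrightarrow> (\<exists>x\<in>sphere 0 1. P x)"
  by (metis (no_types, lifting) dist_0_norm mem_sphere minus_minus norm_minus_cancel)

text \<open>A point \<open>y\<close> outside all caps has \<open>a\<^sub>i \<bullet> y < cos \<alpha>\<close>, so its antipode \<open>- y\<close> is the centre of an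
  open cap of angular radius \<open>\<pi> - \<alpha>\<close> containing every \<open>a\<^sub>i\<close>.\<close>
lemma not_covered_iff_in_open_cap:
  fixes a :: "nat \<Rightarrow> 'a::euclidean_space"
  shows "sphere 0 1 \<noteq> (\<Union>i<n. cap (a i) \<alpha>) \<longleftrightarrow> in_open_cap n (- cos \<alpha>) a"
proof -
  have "sphere 0 1 \<noteq> (\<Union>i<n. cap (a i) \<alpha>) \<longleftrightarrow> (\<exists>x\<in>sphere 0 1. \<forall>i<n. a i \<bullet> x < cos \<alpha>)"
    unfolding cap_def by (auto simp: set_eq_iff not_le)
  also have "\<dots> \<longleftrightarrow> (\<exists>x\<in>sphere 0 1. \<forall>i<n. a i \<bullet> (- x) < cos \<alpha>)"
    using ex_sphere_uminus[of "\<lambda>x. \<forall>i<n. a i \<bullet> x < cos \<alpha>"] by simp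
  also have "\<dots> \<longleftrightarrow> in_open_cap n (- cos \<alpha>) a"
    unfolding in_open_cap_def by (simp add: minus_less_iff)
  finally show ?thesis .
qed

lemma feasible_iff_in_closed_cap:
  fixes A :: "nat \<Rightarrow> 'a::euclidean_space"
  assumes "A \<in> {..<n} \<rightarrow>\<^sub>E sphere 0 1"
  shows "A \<in> feasible_set n \<longleftrightarrow> in_closed_cap n 0 A"
  using assms ex_sphere_uminus[of "\<lambda>x. \<forall>i<n. A i \<bullet> x \<le> 0"]
  unfolding feasible_set_def in_closed_cap_def by simp

text \<open>This identifies \<open>cos \<rho>(A)\<close> with \<open>t(A)\<close>. The admissible radii form the projection of a compact set
  of pairs (radius, centre), so the least one is attained; cosine reverses the order on \<open>[0, \<pi>]\<close>.\<close>
lemma cos_smallest_cap_radius_ge_iff: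
  fixes A :: "nat \<Rightarrow> 'a::euclidean_space"
  assumes A: "\<forall>i<n. A i \<in> sphere 0 1" and c: "\<bar>c\<bar> \<le> 1"
  shows "c \<le> cos (smallest_cap_radius n A) \<longleftrightarrow> in_closed_cap n c A"
proof -
  define R where "R = {r. r \<in> {0..pi} \<and> (\<exists>p\<in>sphere 0 1. \<forall>i<n. A i \<in> cap p r)}"
  have R_iff: "r \<in> R \<longleftrightarrow> r \<in> {0..pi} \<and> in_closed_cap n (cos r) A" for r
  proof -
    have "A i \<in> cap p r \<longleftrightarrow> cos r \<le> A i \<bullet> p" if "i < n" for i p
      using A that by (simp add: cap_def inner_commute)
    then show ?thesis by (simp add: R_def in_closed_cap_def)
  qed
  have "R = fst ` (({0..pi} \<times> sphere 0 1) \<inter> (\<Inter>i<n. {z. cos (fst z) \<le> A i \<bullet> snd z}))"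
  proof (intro equalityI subsetI)
    fix r assume "r \<in> R"
    then obtain p where "r \<in> {0..pi}" "p \<in> sphere 0 1" "\<forall>i<n. cos r \<le> A i \<bullet> p"
      unfolding R_iff in_closed_cap_def by blast
    then have "(r, p) \<in> ({0..pi} \<times> sphere 0 1) \<inter> (\<Inter>i<n. {z. cos (fst z) \<le> A i \<bullet> snd z})"
      by simp
    then show "r \<in> fst ` (({0..pi} \<times> sphere 0 1) \<inter> (\<Inter>i<n. {z. cos (fst z) \<le> A i \<bullet> snd z}))"
      by (rule image_eqI[rotated]) simp
  next
    fix r assume "r \<in> fst ` (({0..pi} \<times> sphere 0 1) \<inter> (\<Inter>i<n. {z. cos (fst z) \<le> A i \<bullet> snd z}))"
    then show "r \<in> R"
      unfolding R_iff in_closed_cap_def by auto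
  qed
  moreover have "closed (\<Inter>i<n. {z. cos (fst z) \<le> A i \<bullet> (snd z :: 'a)})"
    by (intro closed_INT ballI closed_Collect_le continuous_intros)
  ultimately have "compact R"
    by (auto intro!: compact_continuous_image continuous_intros compact_Int_closed compact_Times)
  moreover have "pi \<in> R"
  proof -
    obtain p :: 'a where p: "p \<in> sphere 0 1" using vector_choose_size[of 1] by auto
    have "- 1 \<le> A i \<bullet> p" if "i < n" for i
      using Cauchy_Schwarz_ineq2[of "A i" p] A p that by auto
    with p show ?thesis unfolding R_iff in_closed_cap_def by (auto intro!: bexI[of _ p])
  qed
  ultimately obtain r where r: "r \<in> R" "\<And>s. s \<in> R \<Longrightarrow> r \<le> s"
    using compact_attains_inf[of R] by blast
  have r_eq: "smallest_cap_radius n A = r"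
    unfolding smallest_cap_radius_def
    by (rule Least_equality) (use r in \<open>auto simp: R_def\<close>)
  show ?thesis
  proof
    assume "c \<le> cos (smallest_cap_radius n A)"
    then show "in_closed_cap n c A"
      using r(1) in_closed_cap_antimono unfolding R_iff r_eq by blast
  next
    assume "in_closed_cap n c A"
    then have "arccos c \<in> R"
      using c by (auto simp: R_iff arccos_lbound arccos_ubound cos_arccos_abs)
    then have "r \<le> arccos c" by (rule r(2))
    then have "cos (arccos c) \<le> cos r"
      using r(1) c by (intro cos_monotone_0_pi_le) (auto simp: R_iff arccos_ubound abs_le_iff)
    then show "c \<le> cos (smallest_cap_radius n A)"
      using c by (simp add: r_eq cos_arccos_abs)
  qed
qed

text \<open>Turns a comparison of condition numbers into one of cosines; the convention \<open>1 / 0 = \<infinity>\<close> makes it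
  valid for vanishing cosines as well.\<close>
lemma inverse_ennreal_abs_le_iff:
  "1 / ennreal \<bar>a\<bar> \<le> 1 / ennreal \<bar>b\<bar> \<longleftrightarrow> \<bar>b\<bar> \<le> \<bar>a\<bar>"
proof (cases "a = 0 \<or> b = 0")
  case True
  then show ?thesis
    by (auto simp: divide_ennreal_def top_unique ennreal_inverse_eq_top_iff
        simp flip: inverse_ennreal)
next
  case False
  then show ?thesis
    by (auto simp: divide_ennreal_def inverse_ennreal field_simps)
qed

section \<open>Cells of an arrangement of hyperplanes\<close>

text \<open>A cell of the arrangement of the hyperplanes orthogonal to \<open>a\<^sub>0, \<dots>, a\<^sub>n\<^sub>-\<^sub>1\<close> is encoded by the set
  \<open>\<sigma>\<close> of those indices whose linear form is positive on it.\<close>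
definition realizes :: "nat \<Rightarrow> (nat \<Rightarrow> 'a::euclidean_space) \<Rightarrow> nat set \<Rightarrow> 'a \<Rightarrow> bool" where
  "realizes n a \<sigma> x \<longleftrightarrow> (\<forall>i<n. if i \<in> \<sigma> then 0 < a i \<bullet> x else a i \<bullet> x < 0)"

definition sign_patterns :: "'a::euclidean_space set \<Rightarrow> nat \<Rightarrow> (nat \<Rightarrow> 'a) \<Rightarrow> nat set set" where
  "sign_patterns V n a = {\<sigma>. \<sigma> \<subseteq> {..<n} \<and> (\<exists>x\<in>V. realizes n a \<sigma> x)}"

text \<open>A dimension-free form of general position: a hyperplane of the family contains an intersection of
  others with \<open>V\<close> only if that intersection is \<open>{0}\<close>. In this form it passes to a section of \<open>V\<close> by one
  of the hyperplanes by adding that hyperplane to \<open>I\<close>.\<close>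
definition in_general_position :: "'a::euclidean_space set \<Rightarrow> nat \<Rightarrow> (nat \<Rightarrow> 'a) \<Rightarrow> bool" where
  "in_general_position V n a \<longleftrightarrow> (\<forall>I\<subseteq>{..<n}. \<forall>i\<in>{..<n} - I.
     (\<exists>x\<in>V. x \<noteq> 0 \<and> (\<forall>j\<in>I. a j \<bullet> x = 0)) \<longrightarrow> (\<exists>x\<in>V. (\<forall>j\<in>I. a j \<bullet> x = 0) \<and> a i \<bullet> x \<noteq> 0))"

fun cell_count :: "nat \<Rightarrow> nat \<Rightarrow> nat" where
  "cell_count 0 d = 1"
| "cell_count (Suc n) 0 = 0"
| "cell_count (Suc n) (Suc d) = cell_count n (Suc d) + cell_count n d"

text \<open>Pascal's rule, since the recursion of \<^const>\<open>cell_count\<close> is that of partial row sums of Pascal's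
  triangle.\<close>
lemma cell_count_closed_form: "cell_count (Suc n) (Suc m) = 2 * (\<Sum>k\<le>m. n choose k)"
proof (induction n arbitrary: m)
  case 0
  have "(\<Sum>k\<le>m. (0::nat) choose k) = 1" by (induction m) auto
  then show ?case by simp
next
  case (Suc n)
  show ?case
  proof (cases m)
    case 0
    then show ?thesis using Suc.IH[of 0] by simp
  next
    case (Suc m')
    have "(\<Sum>k\<le>m. Suc n choose k) = (\<Sum>k\<le>m. n choose k) + (\<Sum>k\<le>m'. n choose k)"
      unfolding Suc by (induction m') auto
    then show ?thesis
      using Suc.IH[of m] Suc.IH[of m'] Suc by simp
  qed
qed

lemma realizes_conic_combination:
  assumes "realizes n a \<sigma> x" "realizes n a \<sigma> y" "0 < s" "0 < t"
  shows "realizes n a \<sigma> (s *\<^sub>R x + t *\<^sub>R y)"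
  unfolding realizes_def
proof (intro allI impI)
  fix i assume "i < n"
  then show "if i \<in> \<sigma> then 0 < a i \<bullet> (s *\<^sub>R x + t *\<^sub>R y) else a i \<bullet> (s *\<^sub>R x + t *\<^sub>R y) < 0"
    using assms unfolding realizes_def
    by (auto simp: inner_add_right add_pos_pos add_neg_neg mult_pos_neg split: if_splits)
qed

text \<open>Cells are open, so a point can be moved to both sides along any direction without leaving its
  cell.\<close>
lemma realizes_perturb:
  assumes "realizes n a \<sigma> x"
  obtains e where "0 < e" "realizes n a \<sigma> (x + e *\<^sub>R v)" "realizes n a \<sigma> (x - e *\<^sub>R v)"
proof -
  have "{y. realizes n a \<sigma> y} = (\<Inter>i<n. if i \<in> \<sigma> then {y. 0 < a i \<bullet> y} else {y. a i \<bullet> y < 0})"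
    unfolding realizes_def by auto
  then have "open {y. realizes n a \<sigma> y}"
    by (auto intro!: open_INT open_Collect_less continuous_intros)
  then obtain r where r: "r > 0" "ball x r \<subseteq> {y. realizes n a \<sigma> y}"
    using assms by (auto simp: open_contains_ball)
  define e where "e = r / (norm v + 1)"
  have e: "e > 0" "e * norm v < r"
    using r(1) norm_ge_zero[of v] by (auto simp: e_def field_simps add_pos_nonneg intro!: divide_pos_pos)
  then have "x + e *\<^sub>R v \<in> ball x r" "x - e *\<^sub>R v \<in> ball x r"
    by (simp_all add: dist_norm)
  with r(2) have "realizes n a \<sigma> (x + e *\<^sub>R v)" "realizes n a \<sigma> (x - e *\<^sub>R v)" by blast+
  with e(1) show ?thesis by (rule that)
qed

lemma dim_subspace_hyperplane_section:
  fixes V :: "'a::euclidean_space set"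
  assumes V: "subspace V" and v: "v \<in> V" "b \<bullet> v \<noteq> 0"
  shows "subspace {x \<in> V. b \<bullet> x = 0}" and "dim V = Suc (dim {x \<in> V. b \<bullet> x = 0})"
proof -
  let ?W = "{x \<in> V. b \<bullet> x = 0}"
  have W: "subspace ?W"
    using V unfolding subspace_def by (auto simp: inner_add_right)
  then show "subspace ?W" .
  have "V \<subseteq> span (insert v ?W)"
  proof
    fix x assume x: "x \<in> V"
    have "x - (b \<bullet> x / (b \<bullet> v)) *\<^sub>R v \<in> ?W"
      using V x v by (auto simp: inner_diff_right intro: subspace_diff subspace_scale)
    then show "x \<in> span (insert v ?W)"
      by (meson span_breakdown_eq span_base)
  qed
  moreover have "insert v ?W \<subseteq> V" using v by auto
  ultimately have "dim V = dim (insert v ?W)"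
    by (metis dim_span dim_subset le_antisym)
  also have "\<dots> = Suc (dim ?W)"
  proof -
    have "span ?W = ?W" using W by (simp only: span_eq_iff)
    then have "v \<notin> span ?W" using v by blast
    then show ?thesis by (simp add: dim_insert)
  qed
  finally show "dim V = Suc (dim ?W)" .
qed

text \<open>The deletion-restriction step. A cell of the first \<open>n\<close> hyperplanes is cut in two by the next one
  precisely if it meets that hyperplane, and then it leaves a cell of the induced arrangement there:
  two points of the cell on different sides have a positive combination on the hyperplane, and
  conversely a point on the hyperplane can be pushed off to either side along \<open>v\<close>.\<close>
lemma sign_patterns_Suc_card:
  assumes V: "subspace V" and v: "v \<in> V" "a n \<bullet> v \<noteq> 0"
  shows "card (sign_patterns V (Suc n) a)
       = card (sign_patterns V n a) + card (sign_patterns {x \<in> V. a n \<bullet> x = 0} n a)"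
proof -
  define Pos where "Pos = {\<sigma>. \<sigma> \<subseteq> {..<n} \<and> (\<exists>x\<in>V. realizes n a \<sigma> x \<and> 0 < a n \<bullet> x)}"
  define Neg where "Neg = {\<sigma>. \<sigma> \<subseteq> {..<n} \<and> (\<exists>x\<in>V. realizes n a \<sigma> x \<and> a n \<bullet> x < 0)}"
  have fin: "finite Pos" "finite Neg"
    unfolding Pos_def Neg_def by (auto intro: finite_subset[of _ "Pow {..<n}"])
  have realizes_Suc: "realizes (Suc n) a \<sigma> x \<longleftrightarrow>
      realizes n a (\<sigma> \<inter> {..<n}) x \<and> (if n \<in> \<sigma> then 0 < a n \<bullet> x else a n \<bullet> x < 0)" for \<sigma> x
    unfolding realizes_def by (auto simp: less_Suc_eq)
  \<comment> \<open>A new cell is an old one together with the side of the last hyperplane.\<close>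
  have "sign_patterns V (Suc n) a = insert n ` Pos \<union> Neg"
  proof (intro equalityI subsetI)
    fix \<sigma> assume "\<sigma> \<in> sign_patterns V (Suc n) a"
    then obtain x where x: "\<sigma> \<subseteq> {..<Suc n}" "x \<in> V" "realizes (Suc n) a \<sigma> x"
      unfolding sign_patterns_def by auto
    show "\<sigma> \<in> insert n ` Pos \<union> Neg"
    proof (cases "n \<in> \<sigma>")
      case True
      have "\<sigma> = insert n (\<sigma> \<inter> {..<n})" using True x(1) by (auto simp: less_Suc_eq)
      moreover have "\<sigma> \<inter> {..<n} \<in> Pos" using x True by (auto simp: Pos_def realizes_Suc)
      ultimately show ?thesis by blast
    next
      case False
      then have "\<sigma> \<inter> {..<n} = \<sigma>" using x(1) by (auto simp: less_Suc_eq)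
      then show ?thesis using x False by (auto simp: Neg_def realizes_Suc)
    qed
  next
    fix \<sigma> assume "\<sigma> \<in> insert n ` Pos \<union> Neg"
    then show "\<sigma> \<in> sign_patterns V (Suc n) a"
    proof
      assume "\<sigma> \<in> insert n ` Pos"
      then obtain \<tau> where \<tau>: "\<tau> \<in> Pos" "\<sigma> = insert n \<tau>" by auto
      then have "\<sigma> \<inter> {..<n} = \<tau>" by (auto simp: Pos_def)
      with \<tau> show ?thesis
        unfolding sign_patterns_def by (auto simp: realizes_Suc Pos_def less_Suc_eq)
    next
      assume \<sigma>: "\<sigma> \<in> Neg"
      then have "\<sigma> \<inter> {..<n} = \<sigma>" "n \<notin> \<sigma>" by (auto simp: Neg_def)
      with \<sigma> show ?thesis
        unfolding sign_patterns_def by (force simp: realizes_Suc Neg_def less_Suc_eq)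
    qed
  qed
  moreover have "insert n ` Pos \<inter> Neg = {}" by (auto simp: Neg_def)
  moreover have "inj_on (insert n) Pos" 
  proof (rule inj_onI)
    fix \<sigma> \<tau> assume "\<sigma> \<in> Pos" "\<tau> \<in> Pos" "insert n \<sigma> = insert n \<tau>"
    moreover from this have "n \<notin> \<sigma>" "n \<notin> \<tau>" by (auto simp: Pos_def)
    ultimately show "\<sigma> = \<tau>" by (simp add: insert_ident)
  qed
  ultimately have "card (sign_patterns V (Suc n) a) = card Pos + card Neg"
    using fin by (simp add: card_Un_disjoint card_image)
  also have "\<dots> = card (Pos \<union> Neg) + card (Pos \<inter> Neg)"
    using fin by (rule card_Un_Int)
  also have "Pos \<union> Neg = sign_patterns V n a"
  proof (intro equalityI subsetI)
    fix \<sigma> assume "\<sigma> \<in> sign_patterns V n a"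
    then obtain x where x: "\<sigma> \<subseteq> {..<n}" "x \<in> V" "realizes n a \<sigma> x"
      unfolding sign_patterns_def by auto
    obtain e where e: "0 < e" "realizes n a \<sigma> (x + e *\<^sub>R v)" "realizes n a \<sigma> (x - e *\<^sub>R v)"
      using realizes_perturb[OF x(3)] .
    have in_V: "x + e *\<^sub>R v \<in> V" "x - e *\<^sub>R v \<in> V"
      using V x(2) v(1) by (auto intro: subspace_add subspace_diff subspace_scale)
    \<comment> \<open>If \<open>x\<close> lies on the hyperplane, its perturbation does not.\<close>
    have "a n \<bullet> x \<noteq> 0 \<or> a n \<bullet> (x + e *\<^sub>R v) > 0 \<or> a n \<bullet> (x + e *\<^sub>R v) < 0"
      using e(1) v(2) by (auto simp: inner_add_right neq_iff mult_pos_neg)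
    then show "\<sigma> \<in> Pos \<union> Neg"
      using x e in_V unfolding Pos_def Neg_def by (auto simp: neq_iff)
  qed (auto simp: Pos_def Neg_def sign_patterns_def)
  also have "Pos \<inter> Neg = sign_patterns {x \<in> V. a n \<bullet> x = 0} n a"
  proof (intro equalityI subsetI)
    fix \<sigma> assume "\<sigma> \<in> Pos \<inter> Neg"
    then obtain x y where xy: "\<sigma> \<subseteq> {..<n}" "x \<in> V" "realizes n a \<sigma> x" "0 < a n \<bullet> x"
        "y \<in> V" "realizes n a \<sigma> y" "a n \<bullet> y < 0"
      unfolding Pos_def Neg_def by auto
    \<comment> \<open>The weights are chosen so that the last linear form vanishes.\<close>
    let ?z = "(- (a n \<bullet> y)) *\<^sub>R x + (a n \<bullet> x) *\<^sub>R y"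
    have "realizes n a \<sigma> ?z" using xy by (intro realizes_conic_combination) auto
    moreover have "?z \<in> V" using V xy by (intro subspace_add subspace_scale) auto
    moreover have "a n \<bullet> ?z = 0" unfolding inner_add_right inner_scaleR_right by simp
    ultimately show "\<sigma> \<in> sign_patterns {x \<in> V. a n \<bullet> x = 0} n a"
      using xy(1) unfolding sign_patterns_def by blast
  next
    fix \<sigma> assume "\<sigma> \<in> sign_patterns {x \<in> V. a n \<bullet> x = 0} n a"
    then obtain x where x: "\<sigma> \<subseteq> {..<n}" "x \<in> V" "realizes n a \<sigma> x" "a n \<bullet> x = 0"
      unfolding sign_patterns_def by auto
    obtain e where e: "0 < e" "realizes n a \<sigma> (x + e *\<^sub>R v)" "realizes n a \<sigma> (x - e *\<^sub>R v)"
      using realizes_perturb[OF x(3)] .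
    have in_V: "x + e *\<^sub>R v \<in> V" "x - e *\<^sub>R v \<in> V"
      using V x(2) v(1) by (auto intro: subspace_add subspace_diff subspace_scale)
    have vals: "a n \<bullet> (x + e *\<^sub>R v) = e * (a n \<bullet> v)" "a n \<bullet> (x - e *\<^sub>R v) = - (e * (a n \<bullet> v))"
      using x(4) by (simp_all add: inner_add_right inner_diff_right)
    show "\<sigma> \<in> Pos \<inter> Neg"
    proof (cases "a n \<bullet> v > 0")
      case True
      then have "0 < a n \<bullet> (x + e *\<^sub>R v)" "a n \<bullet> (x - e *\<^sub>R v) < 0" using e(1) by (simp_all add: vals)
      then show ?thesis using x(1) e in_V unfolding Pos_def Neg_def by blast
    next
      case False
      then have "0 < a n \<bullet> (x - e *\<^sub>R v)" "a n \<bullet> (x + e *\<^sub>R v) < 0"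
        using e(1) v(2) by (simp_all add: vals mult_pos_neg)
      then show ?thesis using x(1) e in_V unfolding Pos_def Neg_def by blast
    qed
  qed
  finally show ?thesis .
qed

text \<open>Schlaefli's count. Every deletion-restriction step lowers \<open>n\<close>, and restriction lowers the
  dimension, matching the recursion of \<^const>\<open>cell_count\<close>.\<close>
lemma card_sign_patterns:
  fixes V :: "'a::euclidean_space set"
  assumes "subspace V" "in_general_position V n a"
  shows "card (sign_patterns V n a) = cell_count n (dim V)"
  using assms
proof (induction n arbitrary: V)
  case 0
  have "sign_patterns V 0 a = {{}}"
    using subspace_0[OF 0(1)] by (auto simp: sign_patterns_def realizes_def)
  then show ?case by simp
next
  case (Suc n)
  have gp: "in_general_position V n a"
    using Suc.prems(2) unfolding in_general_position_def by (auto simp: lessThan_Suc)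
  show ?case
  proof (cases "dim V = 0")
    case True
    then have "V \<subseteq> {0}" using dim_eq_0 by blast
    then have "sign_patterns V (Suc n) a = {}"
      by (fastforce simp: sign_patterns_def realizes_def split: if_splits)
    then show ?thesis using True by (simp del: dim_eq_0)
  next
    case False
    then have "\<exists>x\<in>V. x \<noteq> 0 \<and> (\<forall>j\<in>{}. a j \<bullet> x = 0)" by auto
    moreover have "{} \<subseteq> {..<Suc n}" "n \<in> {..<Suc n} - {}" by auto
    ultimately have "\<exists>v\<in>V. (\<forall>j\<in>{}. a j \<bullet> v = 0) \<and> a n \<bullet> v \<noteq> 0"
      using Suc.prems(2) unfolding in_general_position_def by blast
    then obtain v where v: "v \<in> V" "a n \<bullet> v \<noteq> 0" by auto
    let ?W = "{x \<in> V. a n \<bullet> x = 0}"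
    note W = dim_subspace_hyperplane_section[OF Suc.prems(1) v]
    have "in_general_position ?W n a"
      unfolding in_general_position_def
    proof (intro allI impI ballI)
      fix I i assume I: "I \<subseteq> {..<n}" and i: "i \<in> {..<n} - I"
        and ex: "\<exists>x\<in>?W. x \<noteq> 0 \<and> (\<forall>j\<in>I. a j \<bullet> x = 0)"
      have "insert n I \<subseteq> {..<Suc n}" "i \<in> {..<Suc n} - insert n I" using I i by auto
      moreover have "\<exists>x\<in>V. x \<noteq> 0 \<and> (\<forall>j\<in>insert n I. a j \<bullet> x = 0)" using ex by auto
      ultimately have "\<exists>x\<in>V. (\<forall>j\<in>insert n I. a j \<bullet> x = 0) \<and> a i \<bullet> x \<noteq> 0"
        using Suc.prems(2) unfolding in_general_position_def by blast
      then show "\<exists>x\<in>?W. (\<forall>j\<in>I. a j \<bullet> x = 0) \<and> a i \<bullet> x \<noteq> 0" by auto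
    qed
    then have "card (sign_patterns ?W n a) = cell_count n (dim ?W)"
      using W(1) by (rule Suc.IH[rotated])
    then show ?thesis
      using sign_patterns_Suc_card[of V v a n, OF Suc.prems(1) v] Suc.IH[OF Suc.prems(1) gp] W(2)
      by simp
  qed
qed

section \<open>Measurability of conditions on a common centre\<close>

text \<open>Strict inequalities persist near \<open>x\<close>, so the quantifier may be restricted to a countable dense
  subset of \<open>K\<close>.\<close>
lemma measurable_ex_open_halfspaces:
  fixes K :: "'a::euclidean_space set" and b :: "'i \<Rightarrow> 'w \<Rightarrow> 'a"
  assumes "finite I" and b: "\<And>i. i \<in> I \<Longrightarrow> b i \<in> borel_measurable N"
    and c: "\<And>i. i \<in> I \<Longrightarrow> c i \<in> borel_measurable N"
  shows "{\<omega> \<in> space N. \<exists>x\<in>K. \<forall>i\<in>I. c i \<omega> < b i \<omega> \<bullet> x} \<in> sets N"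
proof -
  obtain D where D: "countable D" "D \<subseteq> K" "K \<subseteq> closure D"
    using separable by blast
  have "(\<exists>x\<in>K. \<forall>i\<in>I. c i \<omega> < b i \<omega> \<bullet> x) \<longleftrightarrow> (\<exists>x\<in>D. \<forall>i\<in>I. c i \<omega> < b i \<omega> \<bullet> x)" for \<omega>
  proof
    assume "\<exists>x\<in>K. \<forall>i\<in>I. c i \<omega> < b i \<omega> \<bullet> x"
    then obtain x where x: "x \<in> closure D" "x \<in> (\<Inter>i\<in>I. {x. c i \<omega> < b i \<omega> \<bullet> x})"
      using D by auto
    have "open (\<Inter>i\<in>I. {x. c i \<omega> < b i \<omega> \<bullet> x})"
      using \<open>finite I\<close> by (intro open_INT ballI open_Collect_less continuous_intros)
    then have "(\<Inter>i\<in>I. {x. c i \<omega> < b i \<omega> \<bullet> x}) \<inter> D \<noteq> {}"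
      using x open_Int_closure_eq_empty by blast
    then show "\<exists>x\<in>D. \<forall>i\<in>I. c i \<omega> < b i \<omega> \<bullet> x" by auto
  qed (use D in auto)
  then have "{\<omega> \<in> space N. \<exists>x\<in>K. \<forall>i\<in>I. c i \<omega> < b i \<omega> \<bullet> x}
      = (\<Union>x\<in>D. {\<omega> \<in> space N. \<forall>i\<in>I. c i \<omega> < b i \<omega> \<bullet> x})" by auto
  also have "\<dots> \<in> sets N"
  proof (intro sets.countable_UN'' D)
    fix x assume "x \<in> D"
    show "{\<omega> \<in> space N. \<forall>i\<in>I. c i \<omega> < b i \<omega> \<bullet> x} \<in> sets N"
      using \<open>finite I\<close> by (intro sets.sets_Collect_finite_All borel_measurable_less
          borel_measurable_inner b c) auto
  qed
  finally show ?thesis .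
qed

text \<open>Compactness of \<open>K\<close> lets weak inequalities be approximated by strict ones: centres that satisfy
  the inequalities up to \<open>1 / (k + 1)\<close>, for all \<open>k\<close>, have a common one among them.\<close>
lemma measurable_ex_closed_halfspaces:
  fixes K :: "'a::euclidean_space set" and b :: "'i \<Rightarrow> 'w \<Rightarrow> 'a"
  assumes "finite I" and b: "\<And>i. i \<in> I \<Longrightarrow> b i \<in> borel_measurable N"
    and c: "\<And>i. i \<in> I \<Longrightarrow> c i \<in> borel_measurable N" and K: "compact K"
  shows "{\<omega> \<in> space N. \<exists>x\<in>K. \<forall>i\<in>I. c i \<omega> \<le> b i \<omega> \<bullet> x} \<in> sets N"
proof -
  have "(\<exists>x\<in>K. \<forall>i\<in>I. c i \<omega> \<le> b i \<omega> \<bullet> x)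
      \<longleftrightarrow> (\<forall>k. \<exists>x\<in>K. \<forall>i\<in>I. c i \<omega> - 1 / real (Suc k) < b i \<omega> \<bullet> x)" (is "?L \<longleftrightarrow> ?R") for \<omega>
  proof
    assume ?L
    then obtain x where x: "x \<in> K" "\<forall>i\<in>I. c i \<omega> \<le> b i \<omega> \<bullet> x" by blast
    have "\<forall>i\<in>I. c i \<omega> - 1 / real (Suc k) < b i \<omega> \<bullet> x" for k
    proof
      fix i assume "i \<in> I"
      then have "c i \<omega> \<le> b i \<omega> \<bullet> x" using x(2) by blast
      moreover have "0 < 1 / real (Suc k)" by simp
      ultimately show "c i \<omega> - 1 / real (Suc k) < b i \<omega> \<bullet> x" by linarith
    qed
    with x(1) show ?R by blast
  next
    assume R: ?R
    define F where "F k = K \<inter> (\<Inter>i\<in>I. {x. c i \<omega> - 1 / real (Suc k) \<le> b i \<omega> \<bullet> x})" for k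
    have "\<Inter> (range F) \<noteq> {}"
    proof (rule compact_nest)
      show "compact (F k)" for k
        unfolding F_def using K
        by (intro compact_Int_closed closed_INT ballI closed_Collect_le continuous_intros)
      show "F k \<noteq> {}" for k
        using R unfolding F_def by (fastforce intro: less_imp_le)
      show "F l \<subseteq> F k" if "k \<le> l" for k l
      proof -
        have "1 / real (Suc l) \<le> 1 / real (Suc k)" using that by (simp add: field_simps)
        then show ?thesis unfolding F_def by fastforce
      qed
    qed
    then obtain x where x: "\<And>k. x \<in> F k" by auto
    have "c i \<omega> \<le> b i \<omega> \<bullet> x" if "i \<in> I" for i
    proof (rule LIMSEQ_le_const2)
      show "(\<lambda>k. c i \<omega> - 1 / real (Suc k)) \<longlonglongrightarrow> c i \<omega>"
        using tendsto_diff[OF tendsto_const LIMSEQ_inverse_real_of_nat, of "c i \<omega>"]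
        by (simp add: inverse_eq_divide)
      show "\<exists>N. \<forall>k\<ge>N. c i \<omega> - 1 / real (Suc k) \<le> b i \<omega> \<bullet> x"
        using x that unfolding F_def by auto
    qed
    with x[of 0] show ?L unfolding F_def by blast
  qed
  then have "{\<omega> \<in> space N. \<exists>x\<in>K. \<forall>i\<in>I. c i \<omega> \<le> b i \<omega> \<bullet> x}
      = {\<omega> \<in> space N. \<forall>k. \<exists>x\<in>K. \<forall>i\<in>I. c i \<omega> - 1 / real (Suc k) < b i \<omega> \<bullet> x}" by simp
  also have "\<dots> \<in> sets N"
  proof (rule sets.sets_Collect_countable_All)
    fix k show "{\<omega> \<in> space N. \<exists>x\<in>K. \<forall>i\<in>I. c i \<omega> - 1 / real (Suc k) < b i \<omega> \<bullet> x} \<in> sets N"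
      by (rule measurable_ex_open_halfspaces)
        (use assms in \<open>auto intro!: borel_measurable_diff\<close>)
  qed
  finally show ?thesis .
qed

section \<open>The uniform distribution on the sphere\<close>

text \<open>The radial projection, with the value at the origin chosen on the sphere so that it is a measurable
  map into it; \<^const>\<open>sgn\<close> itself sends the origin to the origin.\<close>
definition to_sphere :: "'a::euclidean_space \<Rightarrow> 'a" where
  "to_sphere x = (if x = 0 then SOME e. e \<in> sphere 0 1 else sgn x)"

lemma to_sphere_in_sphere: "to_sphere x \<in> sphere 0 1"
proof -
  have "\<exists>e::'a. e \<in> sphere 0 1" using vector_choose_size[of 1] by auto
  then show ?thesis unfolding to_sphere_def by (auto simp: norm_sgn intro: someI2_ex)
qed

lemma to_sphere_inner_iff:
  assumes "x \<noteq> 0"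
  shows "c < to_sphere x \<bullet> y \<longleftrightarrow> c * norm x < x \<bullet> y" "c \<le> to_sphere x \<bullet> y \<longleftrightarrow> c * norm x \<le> x \<bullet> y"
  using assms by (auto simp: to_sphere_def sgn_div_norm field_simps)

lemma space_uniform_sphere [simp]: "space uniform_sphere = sphere 0 1"
  unfolding uniform_sphere_def by (simp add: space_restrict_space)

lemma sets_uniform_sphere: "sets (uniform_sphere :: 'a::euclidean_space measure)
    = sets (restrict_space borel (sphere 0 1))"
  unfolding uniform_sphere_def by (intro sets_restrict_space_cong) simp

lemma sets_uniform_sphere_iff:
  "B \<in> sets uniform_sphere \<longleftrightarrow> B \<in> sets borel \<and> B \<subseteq> sphere 0 1"
  unfolding sets_uniform_sphere by (subst sets_restrict_space_iff) auto

lemma measurable_into_uniform_sphere: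
  "f \<in> measurable N uniform_sphere \<longleftrightarrow> f \<in> borel_measurable N \<and> f \<in> space N \<rightarrow> sphere 0 1"
  unfolding measurable_cong_sets[OF refl sets_uniform_sphere]
  by (rule measurable_restrict_space2_iff)

lemma measurable_id_uniform_sphere: "(\<lambda>x. x) \<in> borel_measurable uniform_sphere"
  using measurable_into_uniform_sphere[of "\<lambda>x. x" uniform_sphere] by simp

lemma measurable_to_sphere_borel [measurable]: "to_sphere \<in> borel_measurable borel"
proof -
  have "(\<lambda>x::'a. inverse (norm x) *\<^sub>R x) \<in> borel_measurable borel" by measurable
  then show ?thesis unfolding to_sphere_def[abs_def] sgn_div_norm by measurable
qed

lemma measurable_to_sphere: "to_sphere \<in> measurable borel uniform_sphere"
  using to_sphere_in_sphere unfolding measurable_into_uniform_sphere by auto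

lemma null_sets_hyperplane:
  fixes w :: "'a::euclidean_space"
  assumes "w \<noteq> 0" shows "{y. y \<bullet> w = 0} \<in> null_sets lborel"
proof -
  have "negligible {y. w \<bullet> y = 0}" using assms by (intro negligible_hyperplane) simp
  moreover have "{y. w \<bullet> y = 0} \<in> sets lborel" by simp
  ultimately show ?thesis
    by (simp add: negligible_iff_null_sets null_sets_completion_iff inner_commute)
qed

text \<open>The puncture costs nothing in measure and makes \<^const>\<open>to_sphere\<close> agree with \<^const>\<open>sgn\<close>.\<close>
lemma emeasure_uniform_sphere:
  fixes B :: "'a::euclidean_space set"
  assumes "B \<in> sets uniform_sphere"
  shows "emeasure uniform_sphere B
    = emeasure lborel ((ball 0 1 - {0}) \<inter> to_sphere -` B) / emeasure lborel (ball (0::'a) 1 - {0})"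
proof -
  have B: "B \<in> sets borel" "B \<subseteq> sphere 0 1" using assms by (auto simp: sets_uniform_sphere_iff)
  have [measurable]: "(sgn :: 'a \<Rightarrow> 'a) \<in> borel_measurable borel"
    unfolding sgn_div_norm[abs_def] by measurable
  have m: "sgn \<in> measurable (uniform_measure lborel (ball (0::'a) 1)) borel" by measurable
  have "emeasure uniform_sphere B = emeasure lborel (ball 0 1 \<inter> sgn -` B) / emeasure lborel (ball (0::'a) 1)"
    using B measurable_sets_borel[of sgn borel B] unfolding uniform_sphere_def
    by (subst emeasure_restrict_space) (auto simp: emeasure_distr[OF m])
  also have "ball 0 1 \<inter> sgn -` B = (ball 0 1 - {0}) \<inter> to_sphere -` B"
    using B(2) by (auto simp: to_sphere_def)
  also have "emeasure lborel (ball (0::'a) 1) = emeasure lborel (ball (0::'a) 1 - {0})"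
    by (subst emeasure_Diff_null_set) auto
  finally show ?thesis .
qed

lemma punctured_ball_measure:
  "emeasure lborel (ball (0::'a::euclidean_space) 1 - {0}) \<noteq> 0"
  "emeasure lborel (ball (0::'a::euclidean_space) 1 - {0}) \<noteq> \<infinity>"
proof -
  have eq: "emeasure lborel (ball (0::'a) 1 - {0}) = emeasure lborel (ball (0::'a) 1)"
    by (subst emeasure_Diff_null_set) auto
  show "emeasure lborel (ball (0::'a) 1 - {0}) \<noteq> \<infinity>"
    unfolding eq using emeasure_bounded_finite[of "ball (0::'a) 1"] by auto
  have "\<not> negligible (ball (0::'a) 1)" by (intro open_not_negligible) auto
  then show "emeasure lborel (ball (0::'a) 1 - {0}) \<noteq> 0"
    unfolding eq by (auto simp: negligible_iff_null_sets null_sets_completion_iff null_sets_def)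
qed

lemma prob_space_uniform_sphere: "prob_space uniform_sphere"
proof
  have "sphere 0 1 \<in> sets (uniform_sphere :: 'a measure)" by (simp add: sets_uniform_sphere_iff)
  moreover have "to_sphere -` sphere 0 1 = (UNIV :: 'a set)" using to_sphere_in_sphere by blast
  ultimately show "emeasure uniform_sphere (space (uniform_sphere :: 'a measure)) = 1"
    using punctured_ball_measure[where 'a='a]
    by (simp add: emeasure_uniform_sphere ennreal_divide_self less_top)
qed

text \<open>The cone over a great sphere is a hyperplane, a Lebesgue null set.\<close>
lemma AE_uniform_sphere_inner_nonzero:
  assumes "w \<noteq> 0"
  shows "AE y in uniform_sphere. y \<bullet> w \<noteq> 0"
proof (rule AE_I')
  let ?B = "{y \<in> sphere 0 1. y \<bullet> w = 0}"
  have B: "?B \<in> sets uniform_sphere"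
    unfolding sets_uniform_sphere_iff by (auto intro!: borel_closed closed_Collect_conj closed_Collect_eq continuous_intros simp: dist_norm)
  have "emeasure lborel ((ball 0 1 - {0}) \<inter> to_sphere -` ?B) \<le> emeasure lborel {y. y \<bullet> w = 0}"
    by (intro emeasure_mono) (auto simp: to_sphere_def sgn_div_norm)
  also have "\<dots> = 0" using null_sets_hyperplane[OF assms] by auto
  finally show "?B \<in> null_sets uniform_sphere"
    using B by (auto simp: emeasure_uniform_sphere null_sets_def)
qed auto

lemma lborel_distr_uminus_euclidean: "distr lborel borel uminus = (lborel :: 'a::euclidean_space measure)"
  using lborel_affine[of "-1" "0::'a"] by (simp add: density_1)

text \<open>Lebesgue measure and the ball are invariant under \<open>x \<mapsto> - x\<close>, and \<^const>\<open>to_sphere\<close> commutes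
  with it away from the origin.\<close>
lemma distr_uniform_sphere_uminus: "distr uniform_sphere uniform_sphere uminus = uniform_sphere"
proof (rule measure_eqI)
  fix B :: "'a set" assume "B \<in> sets (distr uniform_sphere uniform_sphere uminus)"
  then have B: "B \<in> sets uniform_sphere" by simp
  have m: "uminus \<in> measurable uniform_sphere (uniform_sphere :: 'a measure)"
    using measurable_id_uniform_sphere unfolding measurable_into_uniform_sphere
    by (auto intro: borel_measurable_uminus)
  let ?B' = "uminus -` B \<inter> space uniform_sphere"
  have B': "?B' \<in> sets uniform_sphere" using m B by (rule measurable_sets)
  let ?C = "\<lambda>B::'a set. (ball 0 1 - {0}) \<inter> to_sphere -` B"
  have C: "?C B \<in> sets borel"
    using measurable_sets_borel[OF measurable_to_sphere_borel, of B] B by (auto simp: sets_uniform_sphere_iff)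
  have "?C ?B' = uminus -` ?C B \<inter> space lborel"
    using to_sphere_in_sphere by (auto simp: to_sphere_def sgn_minus norm_sgn)
  then have "emeasure lborel (?C ?B') = emeasure (distr lborel borel uminus) (?C B)"
    using C by (simp add: emeasure_distr)
  then show "emeasure (distr uniform_sphere uniform_sphere uminus) B = emeasure uniform_sphere B"
    using m B B' by (simp add: emeasure_distr emeasure_uniform_sphere lborel_distr_uminus_euclidean)
qed simp

section \<open>Prescribed values of the smallest cap radius are null events\<close>

text \<open>Infinitely many disjoint sets of equal measure do not fit into a set of finite measure unless
  they are null.\<close>
lemma null_if_disjoint_translates:
  assumes T: "\<And>k. T k \<in> measurable M M" "\<And>k. distr M M (T k) = M"
    and Z: "Z \<in> sets M" and W: "W \<in> sets M" "emeasure M W \<noteq> \<infinity>"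
    and sub: "\<And>k::nat. T k -` Z \<inter> space M \<subseteq> W"
    and disj: "disjoint_family (\<lambda>k. T k -` Z \<inter> space M)"
  shows "emeasure M Z = 0"
proof -
  let ?F = "\<lambda>k. T k -` Z \<inter> space M"
  have F: "?F k \<in> sets M" for k using T(1) Z by (rule measurable_sets)
  have F_eq: "emeasure M (?F k) = emeasure M Z" for k
    using emeasure_distr[OF T(1) Z, of k] T(2)[of k] by simp
  have le: "of_nat N * emeasure M Z \<le> emeasure M W" for N
  proof -
    have "of_nat N * emeasure M Z = (\<Sum>k<N. emeasure M (?F k))" by (simp add: F_eq)
    also have "\<dots> = emeasure M (\<Union>k<N. ?F k)"
      using F disj by (intro sum_emeasure) (auto intro: disjoint_family_on_mono)
    also have "\<dots> \<le> emeasure M W"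
      using sub W(1) by (intro emeasure_mono) auto
    finally show ?thesis .
  qed
  obtain w where w: "emeasure M W = ennreal w" "0 \<le> w"
    using W(2) by (cases "emeasure M W") auto
  have "emeasure M Z \<noteq> \<top>" using le[of 1] W(2) by (auto simp: top_unique)
  then obtain z where z: "emeasure M Z = ennreal z" "0 \<le> z"
    by (cases "emeasure M Z") auto
  have "real N * z \<le> w" for N
  proof -
    have "ennreal (real N * z) \<le> ennreal w"
      using le[of N] w z by (simp add: ennreal_mult ennreal_of_nat_eq_real_of_nat)
    then show ?thesis using w(2) by (simp add: ennreal_le_iff)
  qed
  moreover have "\<exists>N. w < real N * z" if "z > 0"
    using reals_Archimedean3[OF that] by blast
  ultimately have "z \<le> 0" by (meson not_le)
  then show ?thesis using z by simp
qed

interpretation product_lborel: product_sigma_finite "\<lambda>_::nat. lborel :: 'a::euclidean_space measure"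
  by standard

interpretation product_uniform_sphere:
    product_prob_space "\<lambda>_::nat. uniform_sphere :: 'a::euclidean_space measure" UNIV
  by (intro product_prob_spaceI prob_space_uniform_sphere)

abbreviation random_points :: "nat \<Rightarrow> (nat \<Rightarrow> 'a::euclidean_space) measure" where
  "random_points n \<equiv> PiM {..<n} (\<lambda>_. uniform_sphere)"

lemma space_random_points: "space (random_points n) = ({..<n} \<rightarrow>\<^sub>E sphere 0 1)"
  by (simp add: space_PiM)

lemma prob_space_random_points: "prob_space (random_points n)"
  by (intro prob_space_PiM prob_space_uniform_sphere)

lemma measurable_point [measurable]:
  assumes "i < n"
  shows "(\<lambda>A. A i :: 'a::euclidean_space) \<in> borel_measurable (random_points n)"
proof -
  have "(\<lambda>A. A i :: 'a) \<in> measurable (random_points n) uniform_sphere"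
    using assms by (intro measurable_component_singleton) simp
  then show ?thesis by (simp add: measurable_into_uniform_sphere)
qed

lemma distr_shift_product_lborel:
  fixes v :: "'a::euclidean_space" and n :: nat
  shows "distr (PiM {..<n} (\<lambda>_. lborel)) (PiM {..<n} (\<lambda>_. lborel)) (\<lambda>y. \<lambda>i\<in>{..<n}. v + y i)
    = PiM {..<n} (\<lambda>_. lborel)"
proof (rule product_lborel.PiM_eqI)
  fix B :: "nat \<Rightarrow> 'a set" assume "\<And>i. i \<in> {..<n} \<Longrightarrow> B i \<in> sets lborel"
  then have B: "B i \<in> sets borel" if "i < n" for i using that by simp
  have vim: "(+) v -` B i \<in> sets borel" if "i < n" for i
    using B[OF that] measurable_sets_borel[of "(+) v" borel "B i"] by simp
  have "(\<lambda>y. \<lambda>i\<in>{..<n}. v + y i) -` (Pi\<^sub>E {..<n} B) \<inter> space (PiM {..<n} (\<lambda>_. lborel))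
      = Pi\<^sub>E {..<n} (\<lambda>i. (+) v -` B i)"
    by (auto simp: space_PiM PiE_iff)
  moreover have "emeasure lborel ((+) v -` B i) = emeasure lborel (B i)" if "i < n" for i
    using lborel_distr_plus[of v] B[OF that] emeasure_distr[of "(+) v" lborel borel "B i"] by simp
  moreover have "Pi\<^sub>E {..<n} B \<in> sets (PiM {..<n} (\<lambda>_. lborel))"
    using B by (intro sets_PiM_I_finite) auto
  ultimately show "emeasure (distr (PiM {..<n} (\<lambda>_. lborel)) (PiM {..<n} (\<lambda>_. lborel))
      (\<lambda>y. \<lambda>i\<in>{..<n}. v + y i)) (Pi\<^sub>E {..<n} B) = (\<Prod>i\<in>{..<n}. emeasure lborel (B i))"
    using B vim by (subst emeasure_distr) (simp_all, subst product_lborel.emeasure_PiM, simp_all)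
qed simp_all

abbreviation punctured_balls :: "nat \<Rightarrow> (nat \<Rightarrow> 'a::euclidean_space) set" where
  "punctured_balls n \<equiv> {..<n} \<rightarrow>\<^sub>E (ball 0 1 - {0})"

lemma measurable_to_sphere_product:
  "(\<lambda>y. \<lambda>i\<in>{..<n}. to_sphere (y i)) \<in> measurable (PiM {..<n} (\<lambda>_. lborel)) (random_points n)"
  by (intro measurable_restrict measurable_compose[OF measurable_component_singleton])
    (simp_all add: measurable_to_sphere)

text \<open>Lifts the product of uniform distributions to a product of Lebesgue measures, where translations
  are available.\<close>
lemma random_points_eq_distr:
  "random_points n = distr (uniform_measure (PiM {..<n} (\<lambda>_. lborel)) (punctured_balls n))
     (random_points n) (\<lambda>y. \<lambda>i\<in>{..<n}. to_sphere (y i) :: 'a::euclidean_space)" (is "_ = distr ?U _ ?T")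
proof (rule product_uniform_sphere.PiM_eqI[symmetric])
  fix B :: "nat \<Rightarrow> 'a set" assume B: "\<And>i. i \<in> {..<n} \<Longrightarrow> B i \<in> sets uniform_sphere"
  let ?L = "PiM {..<n} (\<lambda>_. lborel :: 'a measure)" and ?b = "ball (0::'a) 1 - {0}"
  let ?C = "\<lambda>i. ?b \<inter> to_sphere -` B i"
  have T: "?T \<in> measurable ?U (random_points n)"
    using measurable_to_sphere_product by (simp cong: measurable_cong_sets)
  have D: "punctured_balls n \<in> sets ?L" by (intro sets_PiM_I_finite) auto
  have C: "?C i \<in> sets lborel" if "i < n" for i
    using B[of i] that measurable_sets_borel[OF measurable_to_sphere_borel, of "B i"]
    by (auto simp: sets_uniform_sphere_iff)
  have box: "Pi\<^sub>E {..<n} B \<in> sets (random_points n)" using B by (intro sets_PiM_I_finite) auto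
  have "punctured_balls n \<inter> (?T -` Pi\<^sub>E {..<n} B \<inter> space ?L) = Pi\<^sub>E {..<n} ?C"
    by (auto simp: space_PiM PiE_iff)
  then have "emeasure (distr ?U (random_points n) ?T) (Pi\<^sub>E {..<n} B)
      = emeasure ?L (Pi\<^sub>E {..<n} ?C) / emeasure ?L (punctured_balls n)"
    using D measurable_sets[OF measurable_to_sphere_product box]
    by (simp add: emeasure_distr[OF T box])
  also have "\<dots> = (\<Prod>i<n. emeasure lborel (?C i)) / emeasure lborel ?b ^ n"
    using C by (subst (1 2) product_lborel.emeasure_PiM) auto
  also have "\<dots> = (\<Prod>i<n. emeasure lborel (?C i) / emeasure lborel ?b)"
    by (simp add: divide_ennreal_def prod.distrib ennreal_inverse_power)
  also have "\<dots> = (\<Prod>i<n. emeasure uniform_sphere (B i))"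
    using B by (intro prod.cong) (auto simp: emeasure_uniform_sphere)
  finally show "emeasure (distr ?U (random_points n) ?T) (Pi\<^sub>E {..<n} B)
      = (\<Prod>i<n. emeasure uniform_sphere (B i))" .
qed simp_all

text \<open>Why \<open>t = c\<close> is a null event. In homogeneous form the event \<open>t = c\<close> says that
  \<open>min\<^sub>i (y\<^sub>i \<bullet> x - c \<parallel>y\<^sub>i\<parallel>)\<close> has maximum \<open>0\<close> over \<open>x\<close>. Suppose the maximum is attained at some \<open>x\<close>
  with \<open>v \<bullet> x > \<bar>c\<bar>\<close>. Adding \<open>s v\<close>, \<open>s > 0\<close>, to all \<open>y\<^sub>i\<close> at once raises each \<open>y\<^sub>i \<bullet> x\<close> by
  \<open>s (v \<bullet> x)\<close> but changes each \<open>c \<parallel>y\<^sub>i\<parallel>\<close> by at most \<open>s \<bar>c\<bar>\<close>, so the maximum becomes positive. Hence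
  translates of the event by different multiples of \<open>(v, \<dots>, v)\<close> are disjoint. Moving all points
  together matters: moving a single one need not change the maximum.\<close>
lemma null_near_direction:
  fixes v :: "'a::euclidean_space"
  assumes K: "compact K" "K \<subseteq> sphere 0 1" and v: "norm v = 1" "\<And>x. x \<in> K \<Longrightarrow> \<bar>c\<bar> < v \<bullet> x"
  shows "{y \<in> punctured_balls n. (\<exists>x\<in>K. \<forall>i\<in>{..<n}. c * norm (y i) \<le> y i \<bullet> x) \<and>
           \<not> (\<exists>x\<in>sphere 0 1. \<forall>i\<in>{..<n}. c * norm (y i) < y i \<bullet> x)}
         \<in> null_sets (PiM {..<n} (\<lambda>_. lborel))" (is "?Z \<in> null_sets ?L")
proof
  let ?T = "\<lambda>k::nat. \<lambda>y. \<lambda>i\<in>{..<n}. (1 / real (Suc k)) *\<^sub>R v + y i"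
  have pt: "(\<lambda>y. y i) \<in> borel_measurable ?L" if "i \<in> {..<n}" for i
    using measurable_component_singleton[OF that, of "\<lambda>_. lborel :: 'a measure"] by simp
  have D: "punctured_balls n \<in> sets ?L" by (intro sets_PiM_I_finite) auto
  have "?Z = punctured_balls n
      \<inter> {y \<in> space ?L. \<exists>x\<in>K. \<forall>i\<in>{..<n}. c * norm (y i) \<le> y i \<bullet> x}
      - {y \<in> space ?L. \<exists>x\<in>sphere 0 1. \<forall>i\<in>{..<n}. c * norm (y i) < y i \<bullet> x}"
    by (auto simp: space_PiM PiE_iff extensional_def)
  also have "\<dots> \<in> sets ?L"
    using K(1) pt D
    by (intro sets.Diff sets.Int measurable_ex_closed_halfspaces measurable_ex_open_halfspaces
        borel_measurable_times borel_measurable_norm measurable_const) simp_all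
  finally show Z: "?Z \<in> sets ?L" .
  \<comment> \<open>The shifts have length at most 1, so all translates stay in balls of radius 2.\<close>
  let ?W = "{..<n} \<rightarrow>\<^sub>E ball (0::'a) 2"
  show "emeasure ?L ?Z = 0"
  proof (rule null_if_disjoint_translates[where T = ?T and W = ?W])
    show "?T k \<in> measurable ?L ?L" for k
      using pt by (intro measurable_restrict) simp
    show "distr ?L ?L (?T k) = ?L" for k by (rule distr_shift_product_lborel)
    show "?W \<in> sets ?L" by (intro sets_PiM_I_finite) auto
    have "emeasure ?L ?W = emeasure lborel (ball (0::'a) 2) ^ n"
      by (simp add: product_lborel.emeasure_PiM)
    then show "emeasure ?L ?W \<noteq> \<infinity>"
      using emeasure_bounded_finite[of "ball (0::'a) 2"] by (simp add: power_eq_top_ennreal less_top)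
    show "?T k -` ?Z \<inter> space ?L \<subseteq> ?W" for k
    proof
      fix y assume y: "y \<in> ?T k -` ?Z \<inter> space ?L"
      have "norm (y i) < 2" if "i < n" for i
      proof -
        have "?T k y \<in> punctured_balls n" using y by simp
        then have "norm ((1 / real (Suc k)) *\<^sub>R v + y i) < 1"
          using that by (auto simp: PiE_iff)
        moreover have "norm ((1 / real (Suc k)) *\<^sub>R v) \<le> 1" using v(1) by simp
        moreover have "norm (y i) \<le> norm ((1 / real (Suc k)) *\<^sub>R v + y i) + norm ((1 / real (Suc k)) *\<^sub>R v)"
          using norm_triangle_ineq4[of "(1 / real (Suc k)) *\<^sub>R v + y i" "(1 / real (Suc k)) *\<^sub>R v"] by simp
        ultimately show ?thesis by linarith
      qed
      then show "y \<in> ?W" using y by (auto simp: space_PiM PiE_iff)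
    qed
    show "disjoint_family (\<lambda>k. ?T k -` ?Z \<inter> space ?L)"
    proof -
      have False if kl: "k < l" and k: "?T k y \<in> ?Z" and l: "?T l y \<in> ?Z" for k l y
      proof -
        define s where "s = 1 / real (Suc k) - 1 / real (Suc l)"
        have s: "s > 0" using kl by (simp add: s_def divide_strict_left_mono)
        obtain x where x: "x \<in> K" "\<And>i. i < n \<Longrightarrow> c * norm (?T l y i) \<le> ?T l y i \<bullet> x"
          using l by blast
        have "c * norm (?T k y i) < ?T k y i \<bullet> x" if i: "i < n" for i
        proof -
          have eq: "?T k y i = ?T l y i + s *\<^sub>R v"
            using i by (simp add: s_def algebra_simps)
          have "c * norm (?T k y i) - c * norm (?T l y i) \<le> \<bar>c\<bar> * \<bar>norm (?T k y i) - norm (?T l y i)\<bar>"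
            by (metis abs_ge_self abs_mult right_diff_distrib')
          also have "\<dots> \<le> \<bar>c\<bar> * s"
            using norm_triangle_ineq3[of "?T k y i" "?T l y i"] s v(1) unfolding eq
            by (intro mult_left_mono) simp_all
          also have "\<dots> < s * (v \<bullet> x)"
            using s v(2)[OF x(1)] by (simp add: mult.commute)
          also have "\<dots> = ?T k y i \<bullet> x - ?T l y i \<bullet> x"
            unfolding eq by (simp add: inner_add_left)
          finally show ?thesis using x(2)[OF i] by linarith
        qed
        moreover have "x \<in> sphere 0 1" using x(1) K(2) by blast
        ultimately show False using k by blast
      qed
      note no_two_shifts = this
      show ?thesis
        unfolding disjoint_family_on_def
      proof (intro ballI impI equals0I)
        fix k l :: nat and y
        assume "k \<noteq> l" "y \<in> (?T k -` ?Z \<inter> space ?L) \<inter> (?T l -` ?Z \<inter> space ?L)"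
        then have "k < l \<or> l < k" "?T k y \<in> ?Z" "?T l y \<in> ?Z" by (simp_all only: Int_iff vimage_eq) auto
        then show False using no_two_shifts by blast
      qed
    qed
  qed (rule Z)
qed

lemma in_caps_measurable:
  shows "{A \<in> space (random_points n). in_open_cap n c A} \<in> sets (random_points n)"
    and "{A \<in> space (random_points n). in_closed_cap n c A} \<in> sets (random_points n)"
proof -
  show "{A \<in> space (random_points n). in_open_cap n c A} \<in> sets (random_points n)"
    unfolding in_open_cap_def
    using measurable_ex_open_halfspaces[of "{..<n}" "\<lambda>i A. A i" "random_points n" "\<lambda>_ _. c" "sphere 0 1"]
      measurable_point by (simp add: Ball_def)
  show "{A \<in> space (random_points n). in_closed_cap n c A} \<in> sets (random_points n)"
    unfolding in_closed_cap_def
    using measurable_ex_closed_halfspaces[of "{..<n}" "\<lambda>i A. A i" "random_points n" "\<lambda>_ _. c" "sphere 0 1"]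
      measurable_point by (simp add: Ball_def)
qed

text \<open>Finitely many directions \<open>v\<close> serve all centres: each unit vector satisfies \<open>v \<bullet> v = 1 > \<bar>c\<bar>\<close>, so
  compactness of the sphere reduces the event \<open>t = c\<close> to finitely many of the null events above.\<close>
lemma AE_in_open_cap_if_closed:
  assumes c: "\<bar>c\<bar> < 1"
  shows "AE A in random_points n. in_closed_cap n c A \<longrightarrow> in_open_cap n c (A :: nat \<Rightarrow> 'a::euclidean_space)"
proof (rule AE_I')
  let ?L = "PiM {..<n} (\<lambda>_. lborel :: 'a measure)" and ?T = "\<lambda>y. \<lambda>i\<in>{..<n}. to_sphere (y i) :: 'a"
  let ?Q = "random_points n :: (nat \<Rightarrow> 'a) measure"
  define B where "B = {A \<in> space ?Q. in_closed_cap n c A} - {A \<in> space ?Q. in_open_cap n c A}"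
  have B: "B \<in> sets ?Q" unfolding B_def using in_caps_measurable by (rule sets.Diff[rotated])
  \<comment> \<open>The midpoint of \<open>\<bar>c\<bar>\<close> and \<open>1\<close> leaves room for pieces that are compact and cover.\<close>
  let ?piece = "\<lambda>v. sphere 0 1 \<inter> {x::'a. (1 + \<bar>c\<bar>) / 2 \<le> v \<bullet> x}"
  obtain F where F: "finite F" "F \<subseteq> sphere (0::'a) 1" "sphere 0 1 \<subseteq> (\<Union>v\<in>F. {x. (1 + \<bar>c\<bar>) / 2 < v \<bullet> x})"
  proof (rule compactE_image)
    show "compact (sphere (0::'a) 1)" by simp
    show "open {x. (1 + \<bar>c\<bar>) / 2 < v \<bullet> x}" for v :: 'a
      by (intro open_Collect_less continuous_intros)
    show "sphere 0 1 \<subseteq> (\<Union>v\<in>sphere 0 1. {x::'a. (1 + \<bar>c\<bar>) / 2 < v \<bullet> x})"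
      using c by (auto simp: dot_square_norm intro!: bexI)
  qed (rule that)
  define Z where "Z v = {y \<in> punctured_balls n. (\<exists>x\<in>?piece v. \<forall>i\<in>{..<n}. c * norm (y i) \<le> y i \<bullet> x) \<and>
           \<not> (\<exists>x\<in>sphere 0 1. \<forall>i\<in>{..<n}. c * norm (y i) < y i \<bullet> x)}" for v
  have "Z v \<in> null_sets ?L" if "v \<in> F" for v
    unfolding Z_def
  proof (rule null_near_direction)
    show "compact (?piece v)"
      by (intro compact_Int_closed closed_Collect_le continuous_intros) simp
    show "norm v = 1" using F(2) that by auto
    show "\<bar>c\<bar> < v \<bullet> x" if "x \<in> ?piece v" for x using that c by auto
  qed auto
  then have null: "(\<Union>v\<in>F. Z v) \<in> null_sets ?L"
    using F(1) by (intro null_sets_UN') (auto intro: countable_finite)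
  have "punctured_balls n \<inter> (?T -` B \<inter> space ?L) \<subseteq> (\<Union>v\<in>F. Z v)"
  proof
    fix y assume y: "y \<in> punctured_balls n \<inter> (?T -` B \<inter> space ?L)"
    then have nz: "y i \<noteq> 0" if "i < n" for i using that by (auto simp: PiE_iff)
    have "in_closed_cap n c (?T y)" "\<not> in_open_cap n c (?T y)" using y by (auto simp: B_def)
    then obtain x where "x \<in> sphere 0 1" "\<forall>i<n. c * norm (y i) \<le> y i \<bullet> x"
      and no: "\<not> (\<exists>x\<in>sphere 0 1. \<forall>i<n. c * norm (y i) < y i \<bullet> x)"
      using nz unfolding in_closed_cap_def in_open_cap_def by (auto simp: to_sphere_inner_iff)
    moreover from this F(3) obtain v where "v \<in> F" "(1 + \<bar>c\<bar>) / 2 < v \<bullet> x" by blast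
    ultimately have "v \<in> F" "y \<in> Z v" using y unfolding Z_def by (auto intro!: bexI[of _ x])
    then show "y \<in> (\<Union>v\<in>F. Z v)" by blast
  qed
  then have "emeasure ?L (punctured_balls n \<inter> (?T -` B \<inter> space ?L)) = 0"
    using null by (metis emeasure_mono null_setsD1 null_setsD2 le_zero_eq)
  moreover have "punctured_balls n \<in> sets ?L" by (intro sets_PiM_I_finite) auto
  moreover have "?T \<in> measurable (uniform_measure ?L (punctured_balls n)) ?Q"
    using measurable_to_sphere_product by (simp cong: measurable_cong_sets)
  ultimately have "emeasure (distr (uniform_measure ?L (punctured_balls n)) ?Q ?T) B = 0"
    using B measurable_sets[OF measurable_to_sphere_product B] by (simp add: emeasure_distr)
  then show "B \<in> null_sets ?Q"
    using B random_points_eq_distr[of n, where 'a='a] by auto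
  show "{A \<in> space ?Q. \<not> (in_closed_cap n c A \<longrightarrow> in_open_cap n c A)} \<subseteq> B"
    unfolding B_def by auto
qed

section \<open>Degenerate configurations\<close>

text \<open>Fubini's theorem in the coordinate \<open>i\<close>.\<close>
lemma null_sets_if_null_slices:
  fixes B :: "(nat \<Rightarrow> 'a::euclidean_space) set"
  assumes B: "B \<in> sets (random_points n)" and i: "i < n"
    and slice: "\<And>A. AE y in uniform_sphere. A(i := y) \<notin> B"
  shows "B \<in> null_sets (random_points n)"
proof -
  let ?I = "{..<n} - {i}"
  have I: "insert i ?I = {..<n}" using i by auto
  have "emeasure (random_points n) B = (\<integral>\<^sup>+A. indicator B A \<partial>random_points n)"
    using B by simp
  also have "\<dots> = (\<integral>\<^sup>+A. (\<integral>\<^sup>+y. indicator B (A(i := y)) \<partial>uniform_sphere) \<partial>PiM ?I (\<lambda>_. uniform_sphere))"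
    using product_uniform_sphere.product_nn_integral_insert[of ?I i "indicator B"] B
    unfolding I by simp
  also have "\<dots> = (\<integral>\<^sup>+A. 0 \<partial>PiM ?I (\<lambda>_. uniform_sphere :: 'a measure))"
  proof (rule nn_integral_cong)
    fix A
    have "(\<integral>\<^sup>+y. indicator B (A(i := y)) \<partial>uniform_sphere) = (\<integral>\<^sup>+y. 0 \<partial>(uniform_sphere :: 'a measure))"
      using slice[of A] by (intro nn_integral_cong_AE) (auto elim: eventually_mono)
    then show "(\<integral>\<^sup>+y. indicator B (A(i := y)) \<partial>uniform_sphere) = 0" by simp
  qed
  finally show ?thesis using B by (simp add: null_sets_def)
qed

text \<open>In dimension at least 2 a point lies on a hyperplane through the origin, and such a hyperplane
  meets the sphere in a null set.\<close>
lemma AE_uniform_sphere_neq: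
  fixes q :: "'a::euclidean_space"
  assumes "2 \<le> DIM('a)"
  shows "AE y in uniform_sphere. y \<noteq> q"
proof -
  obtain w where w: "w \<noteq> 0" "orthogonal q w"
    using orthogonal_to_vector_exists[OF assms, of q] by blast
  show ?thesis
    using AE_uniform_sphere_inner_nonzero[OF w(1)] w(2)
    by (auto simp: orthogonal_def elim: eventually_mono)
qed

lemma eq_if_inner_ge_1:
  fixes x y :: "'a::real_inner"
  assumes "norm x = 1" "norm y = 1" "1 \<le> x \<bullet> y"
  shows "x = y"
proof -
  have "x \<bullet> x = 1" "y \<bullet> y = 1" using assms(1,2) by (simp_all add: dot_square_norm)
  then have "(norm (x - y))\<^sup>2 = 2 - 2 * (x \<bullet> y)"
    by (simp add: power2_norm_eq_inner inner_diff_left inner_diff_right inner_commute)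
  then have "(norm (x - y))\<^sup>2 \<le> 0" using assms(3) by simp
  then show ?thesis by simp
qed

text \<open>A cap of radius \<open>0\<close> holds all points only if they coincide, so a second point is what makes this
  a null event.\<close>
lemma AE_not_in_closed_cap_1:
  assumes dim: "2 \<le> DIM('a::euclidean_space)" and n: "2 \<le> n"
  shows "AE A in random_points n. \<not> in_closed_cap n 1 (A :: nat \<Rightarrow> 'a)"
proof (rule AE_I')
  let ?B = "{A \<in> space (random_points n). in_closed_cap n 1 (A :: nat \<Rightarrow> 'a)}"
  show "?B \<in> null_sets (random_points n)"
  proof (rule null_sets_if_null_slices[OF in_caps_measurable(2), of 0])
    fix A :: "nat \<Rightarrow> 'a"
    have "A(0 := y) \<notin> ?B" if y: "y \<noteq> A 1" for y
    proof
      define C where "C = A(0 := y)"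
      assume "A(0 := y) \<in> ?B"
      then have C: "C \<in> ?B" by (simp only: C_def)
      then obtain x where x: "norm x = 1" "\<forall>i<n. 1 \<le> C i \<bullet> x"
        unfolding in_closed_cap_def by auto
      have unit: "norm (C i) = 1" if "i < n" for i
        using C that by (simp add: space_random_points PiE_iff)
      have "C i = x" if i: "i < n" for i
        using unit[OF i] x(1) x(2)[rule_format, OF i] by (rule eq_if_inner_ge_1)
      from this[of 0] this[of 1] show False using n y by (simp add: C_def)
    qed
    then show "AE y in uniform_sphere. A(0 := y) \<notin> ?B"
      using AE_uniform_sphere_neq[OF dim, of "A 1"] by (auto elim: eventually_mono)
  qed (use n in simp)
qed auto

text \<open>A centre works unless it is the antipode of one of the points; a random centre avoids these finitely
  many antipodes.\<close>
lemma in_open_cap_minus_1: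
  fixes A :: "nat \<Rightarrow> 'a::euclidean_space"
  assumes dim: "2 \<le> DIM('a)" and A: "\<forall>i<n. A i \<in> sphere 0 1"
  shows "in_open_cap n (- 1) A"
proof -
  interpret prob_space "uniform_sphere :: 'a measure" by (rule prob_space_uniform_sphere)
  have ae: "AE y in uniform_sphere. \<forall>i\<in>{..<n}. y \<noteq> - A i"
    using AE_uniform_sphere_neq[OF dim] by (intro AE_finite_allI) auto
  have "\<exists>y\<in>sphere 0 1. \<forall>i\<in>{..<n}. y \<noteq> - A i"
  proof (rule ccontr)
    assume "\<not> ?thesis"
    then have "AE y in uniform_sphere. (\<forall>i\<in>{..<n}. y \<noteq> - A i) \<longrightarrow> False" by (intro AE_I2) auto
    with ae have "AE y in (uniform_sphere :: 'a measure). False" by (rule AE_mp)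
    then show False by simp
  qed
  then obtain y where y: "norm y = 1" "\<And>i. i < n \<Longrightarrow> y \<noteq> - A i" by auto
  have "- 1 < A i \<bullet> y" if "i < n" for i
  proof (rule ccontr)
    assume "\<not> - 1 < A i \<bullet> y"
    then have "1 \<le> y \<bullet> (- A i)" by (simp add: inner_commute)
    then show False using eq_if_inner_ge_1[of y "- A i"] y A that by auto
  qed
  with y(1) show ?thesis unfolding in_open_cap_def by (intro bexI[of _ y]) auto
qed

lemma AE_in_open_cap_iff_closed:
  assumes dim: "2 \<le> DIM('a::euclidean_space)" and c: "\<bar>c\<bar> \<le> 1" "c = 1 \<Longrightarrow> 2 \<le> n"
  shows "AE A in random_points n. in_open_cap n c (A :: nat \<Rightarrow> 'a) \<longleftrightarrow> in_closed_cap n c A"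
proof -
  consider "\<bar>c\<bar> < 1" | "c = 1" | "c = - 1" using c(1) by linarith
  then show ?thesis
  proof cases
    case 1
    show ?thesis
      using AE_in_open_cap_if_closed[OF 1, of n]
      by (rule eventually_mono) (blast intro: in_closed_cap_if_open)
  next
    case 2
    show ?thesis
      unfolding 2 using AE_not_in_closed_cap_1[OF dim c(2)[OF 2]]
      by (rule eventually_mono) (blast intro: in_closed_cap_if_open)
  next
    case 3
    show ?thesis
      unfolding 3
    proof (rule AE_I2)
      fix A :: "nat \<Rightarrow> 'a" assume "A \<in> space (random_points n)"
      then have "in_open_cap n (- 1) A"
        by (intro in_open_cap_minus_1[OF dim]) (auto simp: space_random_points PiE_iff)
      then show "in_open_cap n (- 1) A \<longleftrightarrow> in_closed_cap n (- 1) A"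
        using in_closed_cap_if_open by blast
    qed
  qed
qed

text \<open>Both conditions become existence statements with weak inequalities over the compact sphere, a
  vanishing linear form being a pair of opposite ones. For the nonvanishing form, \<open>x\<close> may be replaced
  by \<open>- x\<close> to make it positive, hence at least \<open>1 / (k + 1)\<close> for some \<open>k\<close>.\<close>
lemma measurable_degenerate_point:
  fixes n i :: nat
  assumes I: "I \<subseteq> {..<n}" and i: "i \<in> {..<n} - I"
  shows "{A \<in> space (random_points n). (\<exists>x\<in>sphere 0 1. \<forall>j\<in>I. A j \<bullet> x = 0)
      \<and> \<not> (\<exists>x\<in>sphere (0::'a::euclidean_space) 1. (\<forall>j\<in>I. A j \<bullet> x = 0) \<and> A i \<bullet> x \<noteq> 0)}
    \<in> sets (random_points n)"
proof -
  let ?Q = "random_points n :: (nat \<Rightarrow> 'a) measure" and ?S = "sphere (0::'a) 1"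
  let ?b = "\<lambda>(j, s) A. if s then A j else - A j :: 'a"
  have fin: "finite I" using I finite_subset by blast
  have b: "?b z \<in> borel_measurable ?Q" if "fst z < n" for z
    using measurable_point[OF that, where 'a='a] by (cases z) auto
  have "(\<exists>x\<in>?S. \<forall>j\<in>I. A j \<bullet> x = 0) \<longleftrightarrow> (\<exists>x\<in>?S. \<forall>z\<in>I \<times> UNIV. 0 \<le> ?b z A \<bullet> x)" for A
    by (intro bex_cong refl) (auto simp: UNIV_bool antisym_conv intro: antisym)
  then have "{A \<in> space ?Q. \<exists>x\<in>?S. \<forall>j\<in>I. A j \<bullet> x = 0}
      = {A \<in> space ?Q. \<exists>x\<in>?S. \<forall>z\<in>I \<times> UNIV. 0 \<le> ?b z A \<bullet> x}" by simp
  also have "\<dots> \<in> sets ?Q"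
    using fin I b by (intro measurable_ex_closed_halfspaces) auto
  finally have 1: "{A \<in> space ?Q. \<exists>x\<in>?S. \<forall>j\<in>I. A j \<bullet> x = 0} \<in> sets ?Q" .
  let ?J = "insert (i, True) (I \<times> UNIV)"
  let ?c = "\<lambda>k z. if fst z = i then 1 / real (Suc k) else 0"
  have "(\<exists>x\<in>?S. (\<forall>j\<in>I. A j \<bullet> x = 0) \<and> A i \<bullet> x \<noteq> 0)
      \<longleftrightarrow> (\<exists>k. \<exists>x\<in>?S. \<forall>z\<in>?J. ?c k z \<le> ?b z A \<bullet> x)" (is "?L \<longleftrightarrow> ?R") for A
  proof
    assume ?L
    then obtain x where x: "x \<in> ?S" "\<forall>j\<in>I. A j \<bullet> x = 0" "A i \<bullet> x \<noteq> 0" by blast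
    obtain x where x: "x \<in> ?S" "\<forall>j\<in>I. A j \<bullet> x = 0" "A i \<bullet> x > 0"
    proof (cases "A i \<bullet> x > 0")
      case False
      then show ?thesis using x that[of "- x"] by auto
    qed (use x that in blast)
    obtain k where "inverse (real (Suc k)) < A i \<bullet> x"
      using reals_Archimedean[OF x(3)] by blast
    then have "\<forall>z\<in>?J. ?c k z \<le> ?b z A \<bullet> x"
      using x i by (auto simp: inverse_eq_divide)
    with x(1) show ?R by blast
  next
    assume ?R
    then obtain k x where x: "x \<in> ?S" "\<forall>z\<in>?J. ?c k z \<le> ?b z A \<bullet> x" by blast
    have "0 < 1 / real (Suc k)" by simp
    also have "\<dots> \<le> A i \<bullet> x" using x(2) by auto
    finally have "A i \<bullet> x \<noteq> 0" by simp
    moreover have "A j \<bullet> x = 0" if "j \<in> I" for j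
    proof -
      have "j \<noteq> i" using that i by auto
      then show ?thesis
        using bspec[OF x(2), of "(j, True)"] bspec[OF x(2), of "(j, False)"] that by auto
    qed
    ultimately show ?L using x(1) by blast
  qed
  then have "{A \<in> space ?Q. \<exists>x\<in>?S. (\<forall>j\<in>I. A j \<bullet> x = 0) \<and> A i \<bullet> x \<noteq> 0}
      = (\<Union>k. {A \<in> space ?Q. \<exists>x\<in>?S. \<forall>z\<in>?J. ?c k z \<le> ?b z A \<bullet> x})" by auto
  also have "\<dots> \<in> sets ?Q"
  proof (rule sets.countable_UN'')
    show "{A \<in> space ?Q. \<exists>x\<in>?S. \<forall>z\<in>?J. ?c k z \<le> ?b z A \<bullet> x} \<in> sets ?Q" for k
      using fin I i b by (intro measurable_ex_closed_halfspaces) auto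
  qed simp
  finally have 2: "{A \<in> space ?Q. \<exists>x\<in>?S. (\<forall>j\<in>I. A j \<bullet> x = 0) \<and> A i \<bullet> x \<noteq> 0} \<in> sets ?Q" .
  show ?thesis using sets.sets_Collect_conj[OF sets.sets_Collect_neg[OF 2] 1] .
qed

text \<open>Fix all points but the one with index \<open>i\<close>, and a unit vector \<open>w\<close> orthogonal to the points with
  index in \<open>I\<close> (without one there is no condition on \<open>i\<close>). If \<open>i\<close> violates general position relative to \<open>I\<close>, its point is orthogonal to \<open>w\<close>,
  which has probability \<open>0\<close>. There are finitely many pairs \<open>(I, i)\<close>.\<close>
lemma AE_in_general_position:
  "AE A in random_points n. in_general_position UNIV n (A :: nat \<Rightarrow> 'a::euclidean_space)"
proof -
  let ?S = "sphere (0::'a) 1"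
  define bad where "bad I i A \<longleftrightarrow> (\<exists>x\<in>?S. \<forall>j\<in>I. A j \<bullet> x = 0)
      \<and> \<not> (\<exists>x\<in>?S. (\<forall>j\<in>I. A j \<bullet> x = 0) \<and> A i \<bullet> x \<noteq> 0)" for I and i :: nat and A
  have "AE A in random_points n. \<not> bad I i A" if I: "I \<subseteq> {..<n}" and i: "i \<in> {..<n} - I" for I i
  proof (rule AE_I')
    show "{A \<in> space (random_points n). bad I i A} \<in> null_sets (random_points n)"
    proof (rule null_sets_if_null_slices[of _ n i])
      show "{A \<in> space (random_points n). bad I i A} \<in> sets (random_points n)"
        using measurable_degenerate_point[OF I i] unfolding bad_def .
      fix A :: "nat \<Rightarrow> 'a"
      have upd: "(A(i := y)) j = A j" if "j \<in> I" for j y using that i by auto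
      show "AE y in uniform_sphere. A(i := y) \<notin> {A \<in> space (random_points n). bad I i A}"
      proof (cases "\<exists>x\<in>?S. \<forall>j\<in>I. A j \<bullet> x = 0")
        case True
        then obtain w where w: "w \<in> ?S" "\<forall>j\<in>I. A j \<bullet> w = 0" by blast
        have "\<not> bad I i (A(i := y))" if "y \<bullet> w \<noteq> 0" for y
          using w that upd unfolding bad_def by (auto intro!: bexI[of _ w])
        moreover have "w \<noteq> 0" using w(1) by auto
        ultimately show ?thesis
          using AE_uniform_sphere_inner_nonzero[of w] by (auto elim!: eventually_mono)
      next
        case False
        then have "\<not> bad I i (A(i := y))" for y using upd unfolding bad_def by simp
        then show ?thesis by simp
      qed
    qed (use i in simp)
  qed auto
  then have "AE A in random_points n. \<forall>z\<in>Sigma (Pow {..<n}) (\<lambda>I. {..<n} - I). \<not> bad (fst z) (snd z) A"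
    by (intro AE_finite_allI finite_SigmaI) auto
  then show ?thesis
  proof (rule eventually_mono)
    fix A assume A: "\<forall>z\<in>Sigma (Pow {..<n}) (\<lambda>I. {..<n} - I). \<not> bad (fst z) (snd z) A"
    show "in_general_position UNIV n A"
      unfolding in_general_position_def
    proof (intro allI impI ballI)
      fix I i assume I: "I \<subseteq> {..<n}" and i: "i \<in> {..<n} - I"
        and "\<exists>x\<in>UNIV. x \<noteq> 0 \<and> (\<forall>j\<in>I. A j \<bullet> x = 0)"
      then obtain x where x: "x \<noteq> 0" "\<forall>j\<in>I. A j \<bullet> x = 0" by blast
      then have "sgn x \<in> ?S" "\<forall>j\<in>I. A j \<bullet> sgn x = 0" by (auto simp: norm_sgn sgn_div_norm)
      moreover have "\<not> bad I i A" using A I i by auto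
      ultimately show "\<exists>x\<in>UNIV. (\<forall>j\<in>I. A j \<bullet> x = 0) \<and> A i \<bullet> x \<noteq> 0"
        unfolding bad_def by blast
    qed
  qed
qed

section \<open>The probability that all points lie in an open hemisphere\<close>

definition flip_signs :: "nat \<Rightarrow> nat set \<Rightarrow> (nat \<Rightarrow> 'a::euclidean_space) \<Rightarrow> nat \<Rightarrow> 'a" where
  "flip_signs n \<sigma> A = (\<lambda>i\<in>{..<n}. if i \<in> \<sigma> then A i else - A i)"

lemma measurable_flip_signs:
  "flip_signs n \<sigma> \<in> measurable (random_points n) (random_points n :: (nat \<Rightarrow> 'a::euclidean_space) measure)"
  unfolding flip_signs_def[abs_def]
proof (rule measurable_restrict)
  fix i assume i: "i \<in> {..<n}"
  have comp: "(\<lambda>A. A i) \<in> measurable (random_points n) (uniform_sphere :: 'a measure)"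
    using i by (rule measurable_component_singleton)
  then show "(\<lambda>A. if i \<in> \<sigma> then A i else - A i) \<in> measurable (random_points n) (uniform_sphere :: 'a measure)"
    unfolding measurable_into_uniform_sphere by (auto simp: Pi_iff)
qed

lemma distr_flip_signs:
  "distr (random_points n) (random_points n) (flip_signs n \<sigma>)
    = (random_points n :: (nat \<Rightarrow> 'a::euclidean_space) measure)"
proof (rule product_uniform_sphere.PiM_eqI)
  fix B :: "nat \<Rightarrow> 'a set" assume B: "\<And>i. i \<in> {..<n} \<Longrightarrow> B i \<in> sets uniform_sphere"
  let ?C = "\<lambda>i. if i \<in> \<sigma> then B i else uminus -` B i \<inter> space uniform_sphere"
  have m: "uminus \<in> measurable uniform_sphere (uniform_sphere :: 'a measure)"
    using measurable_id_uniform_sphere unfolding measurable_into_uniform_sphere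
    by (auto intro: borel_measurable_uminus)
  have C: "?C i \<in> sets uniform_sphere" if "i \<in> {..<n}" for i
    using B[OF that] measurable_sets[OF m B[OF that]] by simp
  have "A \<in> flip_signs n \<sigma> -` Pi\<^sub>E {..<n} B \<inter> space (random_points n) \<longleftrightarrow> A \<in> Pi\<^sub>E {..<n} ?C" for A
  proof -
    have "A \<in> flip_signs n \<sigma> -` Pi\<^sub>E {..<n} B \<inter> space (random_points n) \<longleftrightarrow> A \<in> extensional {..<n} \<and>
        (\<forall>i\<in>{..<n}. (if i \<in> \<sigma> then A i else - A i) \<in> B i \<and> A i \<in> sphere 0 1)"
      unfolding flip_signs_def by (auto simp: space_random_points PiE_iff)
    also have "\<dots> \<longleftrightarrow> A \<in> extensional {..<n} \<and> (\<forall>i\<in>{..<n}. A i \<in> ?C i)"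
    proof (intro conj_cong ball_cong refl)
      fix i assume "i \<in> {..<n}"
      then have "B i \<subseteq> sphere 0 1" using B by (simp add: sets_uniform_sphere_iff)
      then show "(if i \<in> \<sigma> then A i else - A i) \<in> B i \<and> A i \<in> sphere 0 1 \<longleftrightarrow> A i \<in> ?C i" by auto
    qed
    also have "\<dots> \<longleftrightarrow> A \<in> Pi\<^sub>E {..<n} ?C" unfolding PiE_iff by blast
    finally show ?thesis .
  qed
  then have "flip_signs n \<sigma> -` Pi\<^sub>E {..<n} B \<inter> space (random_points n) = Pi\<^sub>E {..<n} ?C" by blast
  moreover have "emeasure uniform_sphere (?C i) = emeasure uniform_sphere (B i)" if "i \<in> {..<n}" for i
    using emeasure_distr[OF m B[OF that]] by (simp add: distr_uniform_sphere_uminus)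
  moreover have "Pi\<^sub>E {..<n} B \<in> sets (random_points n)" using B by (intro sets_PiM_I_finite) auto
  ultimately show "emeasure (distr (random_points n) (random_points n) (flip_signs n \<sigma>)) (Pi\<^sub>E {..<n} B)
      = (\<Prod>i\<in>{..<n}. emeasure uniform_sphere (B i))"
    using C product_uniform_sphere.emeasure_PiM[of "{..<n}" ?C]
    by (simp add: emeasure_distr[OF measurable_flip_signs] del: space_uniform_sphere)
qed simp_all

lemma in_open_cap_flip_signs_iff:
  assumes "n \<ge> 1" "\<sigma> \<subseteq> {..<n}"
  shows "in_open_cap n 0 (flip_signs n \<sigma> A) \<longleftrightarrow> \<sigma> \<in> sign_patterns UNIV n A"
proof -
  have eq: "(\<forall>i<n. 0 < flip_signs n \<sigma> A i \<bullet> x) \<longleftrightarrow> realizes n A \<sigma> x" for x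
    unfolding realizes_def flip_signs_def by (intro all_cong) auto
  have "\<exists>x\<in>sphere 0 1. realizes n A \<sigma> x" if x: "realizes n A \<sigma> x" for x
  proof -
    have "x \<noteq> 0" using x assms(1) unfolding realizes_def by (auto split: if_splits)
    then have "realizes n A \<sigma> (sgn x)" "sgn x \<in> sphere 0 1"
      using x by (auto simp: realizes_def sgn_div_norm norm_sgn zero_less_mult_iff mult_less_0_iff)
    then show ?thesis by blast
  qed
  then show ?thesis
    using assms(2) unfolding in_open_cap_def sign_patterns_def eq by auto
qed

text \<open>Wendel's argument. Flipping the signs of any of the points does not change their joint law, so the
  probability sought is that of each sign pattern being realized by a cell. Averaging over all \<open>2\<^sup>n\<close>
  patterns yields the expected number of cells divided by \<open>2\<^sup>n\<close>; in general position that number is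
  deterministic.\<close>
lemma prob_in_open_hemisphere:
  assumes n: "n \<ge> 1"
  shows "measure (random_points n) {A \<in> space (random_points n). in_open_cap n 0 (A :: nat \<Rightarrow> 'a::euclidean_space)}
    = cell_count n DIM('a) / 2 ^ n"
proof -
  let ?Q = "random_points n :: (nat \<Rightarrow> 'a) measure"
  let ?E = "{A \<in> space ?Q. in_open_cap n 0 A}"
  let ?F = "\<lambda>\<sigma>. {A \<in> space ?Q. \<sigma> \<in> sign_patterns UNIV n A}"
  interpret prob_space ?Q by (rule prob_space_random_points)
  have F_eq: "?F \<sigma> = flip_signs n \<sigma> -` ?E \<inter> space ?Q" if "\<sigma> \<subseteq> {..<n}" for \<sigma>
    using in_open_cap_flip_signs_iff[OF n that, where 'a='a] measurable_space[OF measurable_flip_signs[of n \<sigma>, where 'a='a]]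
    by auto
  have F: "?F \<sigma> \<in> sets ?Q" if "\<sigma> \<subseteq> {..<n}" for \<sigma>
    unfolding F_eq[OF that] by (rule measurable_sets[OF measurable_flip_signs in_caps_measurable(1)])
  have prob_F: "prob (?F \<sigma>) = prob ?E" if "\<sigma> \<subseteq> {..<n}" for \<sigma>
  proof -
    have "measure (distr ?Q ?Q (flip_signs n \<sigma>)) ?E = prob (flip_signs n \<sigma> -` ?E \<inter> space ?Q)"
      by (rule measure_distr[OF measurable_flip_signs in_caps_measurable(1)])
    then show ?thesis unfolding F_eq[OF that] distr_flip_signs by simp
  qed
  have "2 ^ n * prob ?E = (\<Sum>\<sigma>\<in>Pow {..<n}. prob (?F \<sigma>))"
    using prob_F by (simp add: card_Pow)
  also have "\<dots> = (\<Sum>\<sigma>\<in>Pow {..<n}. \<integral>A. indicator (?F \<sigma>) A \<partial>?Q)"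
    using F by (intro sum.cong) auto
  also have "\<dots> = (\<integral>A. (\<Sum>\<sigma>\<in>Pow {..<n}. indicator (?F \<sigma>) A) \<partial>?Q)"
    using F by (intro Bochner_Integration.integral_sum[symmetric]) (auto simp: emeasure_eq_measure intro!: integrable_real_indicator)
  also have "\<dots> = (\<integral>A. real (cell_count n DIM('a)) \<partial>?Q)"
  proof (rule integral_cong_AE)
    show "AE A in ?Q. (\<Sum>\<sigma>\<in>Pow {..<n}. indicator (?F \<sigma>) A) = real (cell_count n DIM('a))"
      using AE_in_general_position AE_space
    proof eventually_elim
      fix A :: "nat \<Rightarrow> 'a" assume A: "in_general_position UNIV n A" "A \<in> space ?Q"
      have "(\<Sum>\<sigma>\<in>Pow {..<n}. indicator (?F \<sigma>) A) = (\<Sum>\<sigma>\<in>sign_patterns UNIV n A. 1::real)"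
        using A(2) by (intro sum.mono_neutral_cong_right) (auto simp: sign_patterns_def)
      also have "\<dots> = real (cell_count n DIM('a))"
        using card_sign_patterns[OF subspace_UNIV A(1)] by (simp add: dim_UNIV)
      finally show "(\<Sum>\<sigma>\<in>Pow {..<n}. indicator (?F \<sigma>) A) = real (cell_count n DIM('a))" .
    qed
  qed (use F in \<open>auto intro!: borel_measurable_sum borel_measurable_indicator\<close>)
  also have "\<dots> = real (cell_count n DIM('a))" by (simp add: prob_space)
  finally show ?thesis by (simp add: field_simps)
qed

section \<open>The covering probability\<close>

theorem proposition1p5:
  fixes M :: "'w measure" and a :: "nat \<Rightarrow> 'w \<Rightarrow> real ^ 'd" and n m :: nat
    and A :: "'w \<Rightarrow> nat \<Rightarrow> real ^ 'd" and p :: "real \<Rightarrow> real"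
  assumes "n \<ge> 1" and "m \<ge> 1" and "CARD('d) = m + 1"
    and "prob_space M"
    and "prob_space.indep_vars M (\<lambda>_. uniform_sphere) a {..<n}"
    and "\<And>i. i < n \<Longrightarrow> distr M uniform_sphere (a i) = uniform_sphere"
  defines "A \<equiv> \<lambda>\<omega>. \<lambda>i\<in>{..<n}. a i \<omega>"
    and "p \<equiv> \<lambda>\<alpha>. \<P>(\<omega> in M. sphere 0 1 \<noteq> (\<Union>i<n. cap (a i \<omega>) \<alpha>))"
  shows "(\<forall>\<alpha>\<in>{pi/2..pi}. \<not> (n = 1 \<and> \<alpha> = pi) \<longrightarrow>
            p \<alpha> = \<P>(\<omega> in M. A \<omega> \<in> feasible_set n \<and> GCC_cond n (A \<omega>) \<le> 1 / ennreal \<bar>cos \<alpha>\<bar>))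
       \<and> (\<forall>\<alpha>\<in>{0..pi/2}.
            p \<alpha> = (\<Sum>k=0..m. real ((n - 1) choose k)) / 2 ^ (n - 1)
                 + \<P>(\<omega> in M. A \<omega> \<notin> feasible_set n \<and> GCC_cond n (A \<omega>) \<ge> 1 / ennreal \<bar>cos \<alpha>\<bar>))
       \<and> p (pi/2) = \<P>(\<omega> in M. A \<omega> \<in> feasible_set n)
       \<and> \<P>(\<omega> in M. A \<omega> \<in> feasible_set n) = 2 powi (1 - int n) * (\<Sum>k=0..m. real ((n - 1) choose k))"
proof -
  let ?Q = "random_points n :: (nat \<Rightarrow> real ^ 'd) measure"
  let ?S = "\<Sum>k=0..m. real ((n - 1) choose k)"
  interpret prob_space M by fact
  interpret Q: prob_space ?Q by (rule prob_space_random_points)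
  have dim: "2 \<le> DIM(real ^ 'd)" and DIM: "DIM(real ^ 'd) = Suc m"
    using assms(2,3) by simp_all
  have rv: "a i \<in> measurable M uniform_sphere" if "i \<in> {..<n}" for i
    using assms(5) that unfolding indep_vars_def by blast
  have A_meas: "A \<in> measurable M ?Q" unfolding A_def using rv by (rule measurable_restrict)
  \<comment> \<open>From here on all events are evaluated in the product of uniform distributions.\<close>
  have law: "distr M ?Q A = ?Q"
  proof -
    have "{..<n} \<noteq> {}" using assms(1) by (simp add: lessThan_empty_iff)
    then have "distr M ?Q A = PiM {..<n} (\<lambda>i. distr M uniform_sphere (a i))"
      using assms(5) rv unfolding A_def by (subst (asm) indep_vars_iff_distr_eq_PiM') auto
    also have "\<dots> = ?Q" using assms(6) by (intro PiM_cong) auto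
    finally show ?thesis .
  qed
  have transfer: "\<P>(\<omega> in M. \<Phi> (A \<omega>)) = Q.prob {B \<in> space ?Q. \<Psi> B}"
    if "{B \<in> space ?Q. \<Psi> B} \<in> sets ?Q" "\<And>B. B \<in> space ?Q \<Longrightarrow> \<Phi> B \<longleftrightarrow> \<Psi> B" for \<Phi> \<Psi>
  proof -
    have "A -` {B \<in> space ?Q. \<Psi> B} \<inter> space M = {\<omega> \<in> space M. \<Phi> (A \<omega>)}"
      using measurable_space[OF A_meas] that(2) by auto
    then show ?thesis using measure_distr[OF A_meas that(1)] by (simp add: law)
  qed
  let ?open = "\<lambda>c. Q.prob {B \<in> space ?Q. in_open_cap n c B}"
  let ?closed = "\<lambda>c. Q.prob {B \<in> space ?Q. in_closed_cap n c B}"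
  have p_eq: "p \<alpha> = ?open (- cos \<alpha>)" for \<alpha>
  proof -
    have "in_open_cap n c (\<lambda>i. a i \<omega>) = in_open_cap n c (A \<omega>)" for c \<omega>
      unfolding in_open_cap_def A_def by simp
    then show ?thesis
      unfolding p_def not_covered_iff_in_open_cap
      using transfer[OF in_caps_measurable(1), of "in_open_cap n (- cos \<alpha>)"] by simp
  qed
  have open_eq_closed: "?open c = ?closed c" if "\<bar>c\<bar> \<le> 1" "c = 1 \<Longrightarrow> 2 \<le> n" for c
    using AE_in_open_cap_iff_closed[OF dim that]
    by (intro Q.finite_measure_eq_AE in_caps_measurable) (auto elim: eventually_mono)
  have feasible: "B \<in> feasible_set n \<longleftrightarrow> in_closed_cap n 0 B" if "B \<in> space ?Q" for B
    using feasible_iff_in_closed_cap[of B n] that by (simp add: space_random_points)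
  have radius: "c \<le> cos (smallest_cap_radius n B) \<longleftrightarrow> in_closed_cap n c B"
    if "B \<in> space ?Q" "\<bar>c\<bar> \<le> 1" for B c
    using that by (intro cos_smallest_cap_radius_ge_iff) (auto simp: space_random_points PiE_iff)
  have prob_feasible: "\<P>(\<omega> in M. A \<omega> \<in> feasible_set n) = ?closed 0"
    using feasible by (intro transfer in_caps_measurable)
  have wendel: "?closed 0 = ?S / 2 ^ (n - 1)"
  proof -
    obtain n' where n': "n = Suc n'" using assms(1) by (cases n) auto
    have "?closed 0 = real (cell_count n (Suc m)) / 2 ^ n"
      using open_eq_closed[of 0] prob_in_open_hemisphere[OF assms(1), where 'a="real ^ 'd"] unfolding DIM by simp
    then show ?thesis
      by (simp add: n' cell_count_closed_form atLeast0AtMost del: cell_count.simps)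
  qed
  have "p \<alpha> = \<P>(\<omega> in M. A \<omega> \<in> feasible_set n \<and> GCC_cond n (A \<omega>) \<le> 1 / ennreal \<bar>cos \<alpha>\<bar>)"
    if \<alpha>: "\<alpha> \<in> {pi/2..pi}" "\<not> (n = 1 \<and> \<alpha> = pi)" for \<alpha>
  proof -
    have cos: "cos \<alpha> \<le> 0" using \<alpha>(1) cos_monotone_0_pi_le[of "pi/2" \<alpha>] by simp
    \<comment> \<open>The atom at \<open>t = 1\<close>, present for a single point, is the excluded case.\<close>
    have "2 \<le> n" if "- cos \<alpha> = 1"
    proof -
      have "cos \<alpha> = cos pi" using that by simp
      then have "\<alpha> = pi" using \<alpha>(1) pi_ge_zero cos_inj_pi[of \<alpha> pi] by auto
      then show ?thesis using \<alpha>(2) assms(1) by auto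
    qed
    then have "p \<alpha> = ?closed (- cos \<alpha>)" unfolding p_eq by (intro open_eq_closed) auto
    also have "\<dots> = \<P>(\<omega> in M. A \<omega> \<in> feasible_set n \<and> GCC_cond n (A \<omega>) \<le> 1 / ennreal \<bar>cos \<alpha>\<bar>)"
    proof (rule transfer[symmetric])
      fix B assume B: "B \<in> space ?Q"
      show "B \<in> feasible_set n \<and> GCC_cond n B \<le> 1 / ennreal \<bar>cos \<alpha>\<bar> \<longleftrightarrow> in_closed_cap n (- cos \<alpha>) B"
        unfolding feasible[OF B] GCC_cond_def inverse_ennreal_abs_le_iff
        using radius[OF B, of 0] radius[OF B, of "- cos \<alpha>"] cos by auto
    qed (rule in_caps_measurable)
    finally show ?thesis .
  qed
  moreover have "p \<alpha> = ?S / 2 ^ (n - 1)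
      + \<P>(\<omega> in M. A \<omega> \<notin> feasible_set n \<and> GCC_cond n (A \<omega>) \<ge> 1 / ennreal \<bar>cos \<alpha>\<bar>)"
    if \<alpha>: "\<alpha> \<in> {0..pi/2}" for \<alpha>
  proof -
    have cos: "0 \<le> cos \<alpha>" using \<alpha> by (intro cos_ge_zero) auto
    let ?G = "\<lambda>B. \<not> in_closed_cap n 0 B \<and> in_closed_cap n (- cos \<alpha>) B"
    have G: "{B \<in> space ?Q. ?G B} \<in> sets ?Q"
      by (intro sets.sets_Collect_conj sets.sets_Collect_neg in_caps_measurable)
    have "p \<alpha> = ?closed (- cos \<alpha>)" unfolding p_eq using cos by (intro open_eq_closed) auto
    \<comment> \<open>The event \<open>- \<epsilon> \<le> t\<close> is split at \<open>0\<close>, the threshold for feasibility.\<close>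
    also have "{B \<in> space ?Q. in_closed_cap n (- cos \<alpha>) B}
        = {B \<in> space ?Q. in_closed_cap n 0 B} \<union> {B \<in> space ?Q. ?G B}"
      using cos by (auto intro: in_closed_cap_antimono)
    also have "Q.prob \<dots> = ?closed 0 + Q.prob {B \<in> space ?Q. ?G B}"
      by (intro Q.finite_measure_Union in_caps_measurable G) auto
    also have "Q.prob {B \<in> space ?Q. ?G B}
        = \<P>(\<omega> in M. A \<omega> \<notin> feasible_set n \<and> GCC_cond n (A \<omega>) \<ge> 1 / ennreal \<bar>cos \<alpha>\<bar>)"
    proof (rule transfer[OF G, symmetric])
      fix B assume B: "B \<in> space ?Q"
      show "B \<notin> feasible_set n \<and> GCC_cond n B \<ge> 1 / ennreal \<bar>cos \<alpha>\<bar> \<longleftrightarrow> ?G B"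
        unfolding feasible[OF B] GCC_cond_def inverse_ennreal_abs_le_iff
        using radius[OF B, of 0] radius[OF B, of "- cos \<alpha>"] cos by auto
    qed
    finally show ?thesis unfolding wendel .
  qed
  moreover have "p (pi/2) = \<P>(\<omega> in M. A \<omega> \<in> feasible_set n)"
    unfolding p_eq prob_feasible using open_eq_closed[of 0] by simp
  moreover have "\<P>(\<omega> in M. A \<omega> \<in> feasible_set n) = 2 powi (1 - int n) * ?S"
  proof -
    have "(2::real) powi (1 - int n) = 1 / 2 ^ (n - 1)"
      using assms(1) by (simp add: power_int_def inverse_eq_divide nat_diff_distrib power_one_over)
    then show ?thesis unfolding prob_feasible wendel by simp
  qed
  ultimately show ?thesis by blast
qed

end
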